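(* Let $p$ be an odd prime and let $G$ be a non-cyclic finite thin $p$-group. Then $G$ has a non-inner automorphism of order $p$, i.e. there exists $\phi \in \operatorname{Aut}(G)$ of order $p$ such that $\phi \notin \operatorname{Inn}(G)$.
   Context: An antichain in a group $G$ is a set of mutually incomparable elements (with respect to inclusion) in the lattice of normal subgroups of $G$. A finite $p$-group $G$ is called thin if every antichain in $G$ contains at most $p+1$ elements. *)

theory Defs
  imports
    "HOL-Computational_Algebra.Primes"
    "HOL-Algebra.Bij"
    "HOL-Algebra.Elementary_Groups"
    "HOL-Algebra.Multiplicative_Group"
begin

definition finite_p_group :: "nat \<Rightarrow> ('a, 'b) monoid_scheme \<Rightarrow> bool" where
  "finite_p_group p G \<longleftrightarrow>
     prime p \<and> group G \<and> finite (carrier G) \<and> (\<exists>n. order G = p ^ n)"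

definition antichain_in :: "('a, 'b) monoid_scheme \<Rightarrow> 'a set set \<Rightarrow> bool" where
  "antichain_in G \<A> \<longleftrightarrow>
     (\<forall>N\<in>\<A>. N \<lhd> G) \<and> pairwise (\<lambda>M N. \<not> M \<subseteq> N \<and> \<not> N \<subseteq> M) \<A>"

definition thin_p_group :: "nat \<Rightarrow> ('a, 'b) monoid_scheme \<Rightarrow> bool" where
  "thin_p_group p G \<longleftrightarrow>
     finite_p_group p G \<and> (\<forall>\<A>. antichain_in G \<A> \<longrightarrow> finite \<A> \<and> card \<A> \<le> p + 1)"

(* Restricted to the carrier because the members of "auto G" are extensional functions. *)
definition inner_auto :: "('a, 'b) monoid_scheme \<Rightarrow> ('a \<Rightarrow> 'a) set" where
  "inner_auto G =
     (\<lambda>g. \<lambda>x\<in>carrier G. g \<otimes>\<^bsub>G\<^esub> x \<otimes>\<^bsub>G\<^esub> inv\<^bsub>G\<^esub> g) ` carrier G"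

end

theory Submission
  imports Defs "HOL-Algebra.Zassenhaus" "HOL-Algebra.Group_Action"
begin

text \<open>
  Suppose that every automorphism of order \<open>p\<close> is inner. Write \<open>Z\<close> for the centre and \<open>E\<close> for its
  elements of exponent \<open>p\<close>, and let \<open>P\<close> consist of the elements that are central modulo \<open>E\<close>.
  As \<open>G\<close> is not cyclic, it has two maximal subgroups \<open>M\<close>. For each of them and each \<open>z \<in> E\<close> the
  automorphism \<open>x \<mapsto> x z ^ \<chi> x\<close>, \<open>\<chi>\<close> a character with kernel \<open>M\<close>, is inner; this makes \<open>P\<close> large.
  On the other hand \<open>P / Z\<close> is elementary abelian and all subgroups between \<open>Z\<close> and \<open>P\<close> are
  normal, so thinness bounds it by \<open>p\<^sup>2\<close>. Hence \<open>E\<close> has order \<open>p\<close>, \<open>P / Z\<close> has order \<open>p\<^sup>2\<close>, and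
  some \<open>n \<in> P\<close> outside \<open>Z\<close> satisfies \<open>n ^ p = 1\<close>. Its centraliser \<open>C\<close> has index \<open>p\<close>, and multiplying
  a generator of \<open>G\<close> modulo \<open>C\<close> by \<open>n\<close> yields an automorphism of order \<open>p\<close> that fixes \<open>C\<close> pointwise. An
  element \<open>g\<close> inducing it is central modulo \<open>\<langle>n\<rangle> E\<close> but not in \<open>P\<close>. The \<open>p\<close> subgroups of index
  \<open>p\<close> in \<open>P\<close> that contain \<open>Z\<close> and differ from \<open>\<langle>n\<rangle> Z\<close>, together with at least \<open>p\<close> normal subgroups that
  contain \<open>\<langle>n\<rangle> Z\<close> with index \<open>p\<close> and are not in \<open>P\<close>, form an antichain of more than \<open>p + 1\<close> elements.
\<close>

section \<open>Commutators and subgroups central modulo a normal subgroup\<close>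

lemma antichain_in_Un:
  assumes "antichain_in G \<A>" "antichain_in G \<B>"
    and "\<And>K L. K \<in> \<A> \<Longrightarrow> L \<in> \<B> \<Longrightarrow> \<not> K \<subseteq> L \<and> \<not> L \<subseteq> K"
  shows "antichain_in G (\<A> \<union> \<B>)"
  unfolding antichain_in_def pairwise_def
proof (intro conjI ballI impI)
  fix K L assume "K \<in> \<A> \<union> \<B>" "L \<in> \<A> \<union> \<B>" "K \<noteq> L"
  then show "\<not> K \<subseteq> L" "\<not> L \<subseteq> K"
    using assms unfolding antichain_in_def pairwise_def by (metis Un_iff)+
qed (use assms in \<open>auto simp: antichain_in_def\<close>)

context group
begin

lemma inv_mult_cancel [simp]:
  "\<lbrakk>x \<in> carrier G; y \<in> carrier G\<rbrakk> \<Longrightarrow> inv x \<otimes> (x \<otimes> y) = y"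
  "\<lbrakk>x \<in> carrier G; y \<in> carrier G\<rbrakk> \<Longrightarrow> x \<otimes> (inv x \<otimes> y) = y"
  by (simp_all flip: m_assoc)

definition commutator :: "'a \<Rightarrow> 'a \<Rightarrow> 'a" where
  "commutator x y = x \<otimes> y \<otimes> inv x \<otimes> inv y"

text \<open>For normal \<open>N\<close> this is the preimage in \<open>G\<close> of the centre of \<open>G Mod N\<close>.\<close>

definition center_mod :: "'a set \<Rightarrow> 'a set" where
  "center_mod N = {h \<in> carrier G. \<forall>x\<in>carrier G. commutator h x \<in> N}"

abbreviation center :: "'a set" where
  "center \<equiv> center_mod {\<one>}"

text \<open>For normal \<open>N\<close> this is the subgroup generated by \<open>h\<close> and \<open>N\<close>.\<close>

definition adjoin :: "'a \<Rightarrow> 'a set \<Rightarrow> 'a set" where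
  "adjoin h N = {h [^] (i::int) \<otimes> k | i k. k \<in> N}"

lemma commutator_closed [simp]:
  "\<lbrakk>x \<in> carrier G; y \<in> carrier G\<rbrakk> \<Longrightarrow> commutator x y \<in> carrier G"
  by (simp add: commutator_def)

lemma mult_eq_commutator:
  "\<lbrakk>x \<in> carrier G; y \<in> carrier G\<rbrakk> \<Longrightarrow> x \<otimes> y = commutator x y \<otimes> (y \<otimes> x)"
  by (simp add: commutator_def m_assoc)

lemma commutator_eqI:
  "\<lbrakk>x \<otimes> y = c \<otimes> (y \<otimes> x); x \<in> carrier G; y \<in> carrier G; c \<in> carrier G\<rbrakk> \<Longrightarrow> commutator x y = c"
  by (simp add: commutator_def m_assoc)

lemma commutator_eq_one_iff:
  "\<lbrakk>x \<in> carrier G; y \<in> carrier G\<rbrakk> \<Longrightarrow> commutator x y = \<one> \<longleftrightarrow> x \<otimes> y = y \<otimes> x"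
  by (metis commutator_eqI l_one mult_eq_commutator m_closed one_closed)

lemma center_mod_subset: "center_mod N \<subseteq> carrier G"
  by (auto simp: center_mod_def)

lemma center_mod_closed: "h \<in> center_mod N \<Longrightarrow> h \<in> carrier G"
  by (auto simp: center_mod_def)

lemma center_modD: "\<lbrakk>h \<in> center_mod N; x \<in> carrier G\<rbrakk> \<Longrightarrow> commutator h x \<in> N"
  by (auto simp: center_mod_def)

lemma center_mod_mono: "N \<subseteq> N' \<Longrightarrow> center_mod N \<subseteq> center_mod N'"
  by (auto simp: center_mod_def)

lemma normal_subset_center_mod:
  assumes "N \<lhd> G"
  shows "N \<subseteq> center_mod N"
proof
  interpret normal N G by fact
  fix h assume h: "h \<in> N"
  have "commutator h x \<in> N" if x: "x \<in> carrier G" for x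
  proof -
    have "h \<otimes> (x \<otimes> inv h \<otimes> inv x) \<in> N"
      using h x by (intro subgroup.m_closed[OF subgroup_axioms] inv_op_closed2) auto
    then show ?thesis using h x by (simp add: commutator_def m_assoc)
  qed
  then show "h \<in> center_mod N" using h by (auto simp: center_mod_def)
qed

lemma commutator_mult:
  assumes "h \<in> carrier G" "k \<in> carrier G" "x \<in> carrier G"
  shows "commutator (h \<otimes> k) x = h \<otimes> commutator k x \<otimes> inv h \<otimes> commutator h x"
  using assms by (simp add: commutator_def m_assoc inv_mult_group)

lemma commutator_inv:
  assumes "h \<in> carrier G" "x \<in> carrier G"
  shows "commutator (inv h) x = inv h \<otimes> inv (commutator h x) \<otimes> h"
  using assms by (simp add: commutator_def m_assoc inv_mult_group)

lemma subgroup_center_mod: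
  assumes "N \<lhd> G"
  shows "subgroup (center_mod N) G"
proof
  interpret normal N G by fact
  show "center_mod N \<subseteq> carrier G" by (rule center_mod_subset)
  show "\<one> \<in> center_mod N"
    using normal_subset_center_mod[OF assms] by auto
  fix h assume h: "h \<in> center_mod N"
  show "inv h \<in> center_mod N"
    using h by (auto simp: center_mod_def commutator_inv intro!: inv_op_closed1)
  fix k assume k: "k \<in> center_mod N"
  show "h \<otimes> k \<in> center_mod N"
  proof -
    have "commutator (h \<otimes> k) x \<in> N" if x: "x \<in> carrier G" for x
    proof -
      have "h \<otimes> commutator k x \<otimes> inv h \<in> N" "commutator h x \<in> N"
        using h k x by (auto simp: center_mod_def intro!: inv_op_closed2)
      then show ?thesis
        using h k x by (auto simp: center_mod_def commutator_mult)
    qed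
    then show ?thesis using h k by (auto simp: center_mod_def)
  qed
qed

text \<open>The conjugate of \<open>k\<close> by \<open>x\<close> is
  \<open>inv (commutator k x) \<otimes> k\<close>.\<close>

lemma normal_if_commutators:
  assumes "subgroup K G" "\<And>k x. k \<in> K \<Longrightarrow> x \<in> carrier G \<Longrightarrow> commutator k x \<in> K"
  shows "K \<lhd> G"
proof -
  interpret subgroup K G by fact
  have "x \<otimes> k \<otimes> inv x \<in> K" if k: "k \<in> K" and x: "x \<in> carrier G" for x k
  proof -
    have "inv (commutator k x) \<otimes> k \<in> K"
      using assms(2)[OF k x] k by simp
    then show ?thesis using k x by (simp add: commutator_def m_assoc inv_mult_group)
  qed
  then show ?thesis using assms(1) by (simp add: normal_inv_iff)
qed

lemma normal_center_mod:
  assumes "N \<lhd> G"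
  shows "center_mod N \<lhd> G"
  using normal_subset_center_mod[OF assms]
  by (intro normal_if_commutators subgroup_center_mod assms) (auto simp: center_mod_def)

section \<open>Adjoining an element to a normal subgroup\<close>

lemma adjoin_eq_set_mult:
  assumes "h \<in> carrier G"
  shows "adjoin h N = generate G {h} <#> N"
  using assms by (auto simp: adjoin_def set_mult_def generate_pow)

lemma subgroup_adjoin:
  assumes "h \<in> carrier G" "N \<lhd> G"
  shows "subgroup (adjoin h N) G"
proof -
  have sub: "subgroup (generate G {h}) G"
    using assms by (intro generate_is_subgroup) auto
  have "adjoin h N = N <#> generate G {h}"
    using assms sub by (simp add: adjoin_eq_set_mult commut_normal)
  then show ?thesis using mult_norm_subgroup[OF assms(2) sub] by simp
qed

lemma mem_adjoin:
  assumes "h \<in> carrier G" "N \<lhd> G"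
  shows "h \<in> adjoin h N"
proof -
  have "h = h [^] (1::int) \<otimes> \<one>" "\<one> \<in> N"
    using assms by (auto simp: normal_imp_subgroup subgroup.one_closed)
  then show ?thesis unfolding adjoin_def by blast
qed

lemma subset_adjoin:
  assumes "N \<lhd> G"
  shows "N \<subseteq> adjoin h N"
proof
  fix k assume k: "k \<in> N"
  then have "k = h [^] (0::int) \<otimes> k"
    using assms normal_imp_subgroup subgroup.mem_carrier by fastforce
  then show "k \<in> adjoin h N" using k unfolding adjoin_def by blast
qed

lemma adjoin_least:
  assumes "subgroup K G" "h \<in> K" "N \<subseteq> K"
  shows "adjoin h N \<subseteq> K"
  using assms subgroup_int_pow_closed[OF assms(1,2)] subgroup.m_closed[OF assms(1)]
  by (auto simp: adjoin_def)

text \<open>\<open>adjoin h N\<close> lies inside the subgroup \<open>center_mod N\<close>, so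
  commutators of its elements already fall into \<open>N\<close>.\<close>

lemma normal_adjoin:
  assumes "N \<lhd> G" "h \<in> center_mod N"
  shows "adjoin h N \<lhd> G"
proof (rule normal_if_commutators)
  have h: "h \<in> carrier G" using assms center_mod_subset by auto
  show "subgroup (adjoin h N) G" by (rule subgroup_adjoin[OF h assms(1)])
  fix k x assume "k \<in> adjoin h N" "x \<in> carrier G"
  moreover have "adjoin h N \<subseteq> center_mod N"
    using assms by (intro adjoin_least subgroup_center_mod normal_subset_center_mod)
  ultimately have "commutator k x \<in> N" by (auto simp: center_mod_def)
  then show "commutator k x \<in> adjoin h N" using subset_adjoin[OF assms(1)] by blast
qed

lemma mem_if_coprime_pow_mem:
  assumes "subgroup K G" "h \<in> carrier G" "h [^] (m::int) \<in> K" "h [^] (i::int) \<in> K" "coprime m i"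
  shows "h \<in> K"
proof -
  obtain u v where uv: "u * m + v * i = 1"
    using bezout_int[of m i] assms(5) by auto
  have "h = h [^] (m * u + i * v)"
    using uv assms(2) by (simp add: mult.commute)
  also have "\<dots> = (h [^] m) [^] u \<otimes> (h [^] i) [^] v"
    using assms(2) by (simp add: int_pow_mult int_pow_pow)
  finally show ?thesis
    using assms by (metis subgroup.m_closed subgroup_int_pow_closed)
qed

lemma mem_if_prime_pow_mem:
  fixes p :: nat
  assumes "prime p" "subgroup K G" "h \<in> carrier G" "h [^] p \<in> K" "h [^] (i::int) \<in> K"
    and "\<not> int p dvd i"
  shows "h \<in> K"
  using assms
  by (intro mem_if_coprime_pow_mem[of K h "int p" i])
     (auto simp: int_pow_int intro!: prime_imp_coprime)

lemma pow_mod_mem: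
  fixes p :: nat
  assumes "subgroup K G" "h \<in> carrier G" "h [^] p \<in> K" "int p dvd i"
  shows "h [^] (i::int) \<in> K"
proof -
  obtain k where "i = int p * k" using assms(4) by auto
  then show ?thesis
    using assms by (metis int_pow_int int_pow_pow subgroup_int_pow_closed)
qed

text \<open>In \<open>h = h' [^] i \<otimes> k\<close> the prime \<open>p\<close> cannot divide
  \<open>i\<close>, as otherwise \<open>h\<close> would lie in \<open>N\<close>. So
  \<open>adjoin h N\<close> contains \<open>h' [^] i\<close> and \<open>h' [^] p\<close> with
  coprime exponents, and hence \<open>h'\<close>.\<close>

lemma adjoin_exchange:
  fixes p :: nat
  assumes "prime p" "N \<lhd> G" "h \<in> carrier G" "h' \<in> carrier G" "h' [^] p \<in> N"
    and "h \<notin> N" "h \<in> adjoin h' N"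
  shows "h' \<in> adjoin h N"
proof -
  interpret normal N G by fact
  obtain i :: int and k where hk: "h = h' [^] i \<otimes> k" "k \<in> N"
    using assms(7) by (auto simp: adjoin_def)
  have sub: "subgroup (adjoin h N) G" by (rule subgroup_adjoin[OF assms(3,2)])
  have kc: "k \<in> carrier G" using hk by auto
  have "h' [^] i = h \<otimes> inv k"
    using hk kc assms by (simp add: m_assoc)
  moreover have "h \<otimes> inv k \<in> adjoin h N"
    using hk assms mem_adjoin subset_adjoin[OF assms(2)] sub
    by (meson m_inv_closed subgroup.m_closed subsetD)
  moreover have "\<not> int p dvd i"
  proof
    assume "int p dvd i"
    then have "h' [^] i \<in> N"
      using assms subgroup_axioms by (intro pow_mod_mem)
    then show False using hk assms by auto
  qed
  ultimately show ?thesis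
    using assms sub subset_adjoin[OF assms(2)]
    by (intro mem_if_prime_pow_mem[of p "adjoin h N" h' i]) auto
qed

lemma adjoin_diff_subset:
  fixes p :: nat
  assumes "p > 0" "N \<lhd> G" "h \<in> carrier G" "h [^] p \<in> N"
  shows "adjoin h N - N \<subseteq> (\<lambda>(i, k). h [^] (i::nat) \<otimes> k) ` ({1..<p} \<times> N)"
proof
  interpret normal N G by fact
  fix y assume y: "y \<in> adjoin h N - N"
  then obtain i :: int and k where hk: "y = h [^] i \<otimes> k" "k \<in> N"
    by (auto simp: adjoin_def)
  \<comment> \<open>Reduce the exponent modulo \<open>p\<close>; the remaining power of
    \<open>h\<close>, with exponent a multiple of \<open>p\<close>, is absorbed into
    \<open>N\<close>.\<close>
  define j where "j = nat (i mod int p)"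
  have j: "int j = i mod int p" "j < p"
    using assms(1) by (simp_all add: j_def nat_less_iff)
  have "i = int j + int p * (i div int p)"
    using j by simp
  then have "h [^] i = h [^] int j \<otimes> h [^] (int p * (i div int p))"
    using int_pow_mult[OF assms(3)] by metis
  moreover define k' where "k' = h [^] (int p * (i div int p)) \<otimes> k"
  moreover have "h [^] (int p * (i div int p)) \<in> N"
    using assms by (intro pow_mod_mem[of N h p]) (auto intro: subgroup_axioms)
  ultimately have "y = h [^] j \<otimes> k'" "k' \<in> N"
    using hk assms by (auto simp: int_pow_int m_assoc)
  \<comment> \<open>Exponent 0 would put \<open>y\<close> into \<open>N\<close>; excluding it gives
    the factor \<open>p - 1\<close> in the count below.\<close>
  moreover have "j \<noteq> 0"
    using calculation y by (metis Diff_iff l_one mem_carrier nat_pow_0)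
  ultimately show "y \<in> (\<lambda>(i, k). h [^] (i::nat) \<otimes> k) ` ({1..<p} \<times> N)"
    using j by force
qed

lemma card_adjoin_diff:
  fixes p :: nat
  assumes "p > 0" "N \<lhd> G" "finite N" "h \<in> carrier G" "h [^] p \<in> N"
  shows "finite (adjoin h N - N)" and "card (adjoin h N - N) \<le> (p - 1) * card N"
proof -
  let ?f = "\<lambda>(i, k). h [^] (i::nat) \<otimes> k"
  have sub: "adjoin h N - N \<subseteq> ?f ` ({1..<p} \<times> N)"
    by (rule adjoin_diff_subset) fact+
  have fin: "finite (?f ` ({1..<p} \<times> N))"
    using assms(3) by simp
  show "finite (adjoin h N - N)" by (rule finite_subset[OF sub fin])
  have "card (?f ` ({1..<p} \<times> N)) \<le> card ({1..<p} \<times> N)"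
    using assms(3) by (intro card_image_le) auto
  then show "card (adjoin h N - N) \<le> (p - 1) * card N"
    using card_mono[OF fin sub] by (simp add: card_cartesian_product)
qed

lemma card_adjoin_le:
  fixes p :: nat
  assumes "p > 0" "N \<lhd> G" "finite N" "h \<in> carrier G" "h [^] p \<in> N"
  shows "card (adjoin h N) \<le> p * card N"
proof -
  have "adjoin h N = N \<union> (adjoin h N - N)" using subset_adjoin[OF assms(2)] by auto
  then have "card (adjoin h N) \<le> card N + card (adjoin h N - N)"
    by (metis card_Un_le)
  also have "\<dots> \<le> card N + (p - 1) * card N" using card_adjoin_diff(2)[OF assms] by simp
  also have "\<dots> = p * card N" using assms(1) by (cases p) auto
  finally show ?thesis .
qed

text \<open>Elements of \<open>Q - S\<close> lie outside \<open>N\<close>, so by the exchange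
  property two of the subgroups \<open>adjoin h N\<close> coincide as soon as one contains the
  other. Each has at most \<open>(p - 1) * card N\<close> elements outside \<open>N\<close>, and
  together these cover \<open>Q - S\<close>: a large \<open>Q - S\<close> forces a large
  antichain.\<close>

lemma antichain_layer:
  fixes p :: nat
  assumes "prime p" "N \<lhd> G" "N \<subseteq> S" "Q \<subseteq> center_mod N" "\<And>h. h \<in> Q \<Longrightarrow> h [^] p \<in> N"
    and fin: "finite (carrier G)"
  shows "antichain_in G ((\<lambda>h. adjoin h N) ` (Q - S))"
    and "card (Q - S) \<le> card ((\<lambda>h. adjoin h N) ` (Q - S)) * ((p - 1) * card N)"
proof -
  interpret normal N G by fact
  have Qc: "h \<in> carrier G" if "h \<in> Q" for h
    using assms(4) center_mod_subset that by auto
  let ?F = "(\<lambda>h. adjoin h N) ` (Q - S)"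
  have eq: "adjoin h N = adjoin h' N"
    if "h \<in> Q - S" "h' \<in> Q - S" "adjoin h N \<subseteq> adjoin h' N" for h h'
  proof -
    have "h' \<in> adjoin h N"
      using that assms Qc mem_adjoin by (intro adjoin_exchange[of p N h h']) auto
    then have "adjoin h' N \<subseteq> adjoin h N"
      using that Qc assms by (intro adjoin_least subgroup_adjoin subset_adjoin) auto
    with that show ?thesis by auto
  qed
  show "antichain_in G ?F"
    unfolding antichain_in_def pairwise_def using eq assms by (auto intro!: normal_adjoin)
  have finQ: "finite (Q - S)" and finN: "finite N"
    using Qc fin subset by (auto intro: finite_subset)
  have "Q - S \<subseteq> (\<Union>K\<in>?F. K - N)"
    using Qc mem_adjoin assms by auto
  moreover have fK: "finite (K - N) \<and> card (K - N) \<le> (p - 1) * card N" if K: "K \<in> ?F" for K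
  proof -
    obtain h where h: "h \<in> Q - S" "K = adjoin h N" using K by auto
    have "h \<in> carrier G" "h [^] p \<in> N" using h Qc assms(5) by auto
    then show ?thesis
      unfolding h(2) using card_adjoin_diff[OF _ assms(2) finN] prime_gt_0_nat[OF assms(1)] by simp
  qed
  ultimately have "card (Q - S) \<le> card (\<Union>K\<in>?F. K - N)"
    using finQ fK by (intro card_mono finite_UN_I finite_imageI) auto
  also have "\<dots> \<le> (\<Sum>K\<in>?F. card (K - N))"
    using finQ by (intro card_UN_le) auto
  also have "\<dots> \<le> (\<Sum>K\<in>?F. (p - 1) * card N)"
    using fK by (intro sum_mono) auto
  finally show "card (Q - S) \<le> card ?F * ((p - 1) * card N)" by simp
qed

section \<open>Powers of elements that commute up to a central factor\<close>

lemma central_pow: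
  assumes "e \<in> center"
  shows "e [^] (i::nat) \<in> center"
proof -
  interpret subgroup "center" G by (rule subgroup_center_mod[OF one_is_normal])
  show ?thesis using assms by (induction i) auto
qed

lemma mem_center_iff:
  "e \<in> center \<longleftrightarrow> e \<in> carrier G \<and> (\<forall>x\<in>carrier G. e \<otimes> x = x \<otimes> e)"
  by (auto simp: center_mod_def commutator_eq_one_iff)

lemma center_commute:
  "\<lbrakk>e \<in> center; x \<in> carrier G\<rbrakk> \<Longrightarrow> e \<otimes> x = x \<otimes> e"
  by (simp add: mem_center_iff)

lemma center_left_commute:
  "\<lbrakk>e \<in> center; x \<in> carrier G; y \<in> carrier G\<rbrakk> \<Longrightarrow> x \<otimes> (e \<otimes> y) = e \<otimes> (x \<otimes> y)"
  using m_assoc[of x e y] m_assoc[of e x y] by (simp add: mem_center_iff)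

lemma pow_mult_commute:
  assumes "h \<in> carrier G" "k \<in> carrier G" "e \<in> center" "h \<otimes> k = e \<otimes> (k \<otimes> h)"
  shows "h [^] (i::nat) \<otimes> k = e [^] i \<otimes> (k \<otimes> h [^] i)"
proof (induction i)
  case (Suc i)
  have e: "e \<in> carrier G" using assms(3) by (simp add: mem_center_iff)
  have "h [^] Suc i \<otimes> k = h [^] i \<otimes> (e \<otimes> (k \<otimes> h))"
    using assms by (simp add: m_assoc)
  also have "\<dots> = e \<otimes> (h [^] i \<otimes> k \<otimes> h)"
    using assms e by (simp add: center_left_commute m_assoc)
  also have "\<dots> = e \<otimes> (e [^] i \<otimes> (k \<otimes> h [^] i) \<otimes> h)"
    by (simp only: Suc)
  also have "\<dots> = e [^] Suc i \<otimes> (k \<otimes> h [^] Suc i)"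
    using assms e by (simp add: m_assoc center_left_commute[of e "e [^] i"])
  finally show ?case .
qed (use assms in auto)

text \<open>Collection process: a further factor \<open>k\<close> has to pass
  \<open>h [^] i\<close>, which costs \<open>e [^] i\<close>.\<close>

lemma mult_pow_central_commutator:
  assumes "h \<in> carrier G" "k \<in> carrier G" "e \<in> center" "h \<otimes> k = e \<otimes> (k \<otimes> h)"
  shows "(k \<otimes> h) [^] (i::nat) = e [^] (\<Sum>j<i. j) \<otimes> (k [^] i \<otimes> h [^] i)"
proof (induction i)
  case (Suc i)
  have e: "e \<in> carrier G" using assms(3) by (simp add: mem_center_iff)
  have ei: "e [^] j \<in> center" for j :: nat by (rule central_pow[OF assms(3)])
  have "(k \<otimes> h) [^] Suc i = e [^] (\<Sum>j<i. j) \<otimes> (k [^] i \<otimes> ((h [^] i \<otimes> k) \<otimes> h))"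
    using assms e by (simp add: Suc m_assoc)
  also have "\<dots> = e [^] (\<Sum>j<i. j) \<otimes> (k [^] i \<otimes> (e [^] i \<otimes> (k \<otimes> h [^] i \<otimes> h)))"
    using assms e by (simp add: pow_mult_commute[OF assms] m_assoc)
  also have "\<dots> = e [^] (\<Sum>j<i. j) \<otimes> (e [^] i \<otimes> (k [^] i \<otimes> (k \<otimes> h [^] i \<otimes> h)))"
    using assms e ei by (simp add: center_left_commute)
  also have "\<dots> = e [^] (\<Sum>j<Suc i. j) \<otimes> (k [^] Suc i \<otimes> h [^] Suc i)"
    using assms e by (simp add: m_assoc flip: nat_pow_mult)
  finally show ?case .
qed (use assms in auto)

text \<open>The collected exponent is \<open>p * ((p - 1) div 2)\<close>, a multiple of
  \<open>p\<close> because \<open>p\<close> is odd, so the central correction vanishes.\<close>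

lemma mult_pow_odd:
  assumes "h \<in> carrier G" "k \<in> carrier G" "e \<in> center" "h \<otimes> k = e \<otimes> (k \<otimes> h)"
    and "odd p" "e [^] (p::nat) = \<one>"
  shows "(k \<otimes> h) [^] p = k [^] p \<otimes> h [^] p"
proof -
  have e: "e \<in> carrier G" using assms(3) by (simp add: mem_center_iff)
  have "(\<Sum>j<p. j) = p * ((p - 1) div 2)"
    using assms(5) by (auto simp: Sum_Ico_nat lessThan_atLeast0 elim!: oddE)
  then have "e [^] (\<Sum>j<p. j) = \<one>"
    using assms(6) e by (simp flip: nat_pow_pow)
  then show ?thesis
    using mult_pow_central_commutator[OF assms(1-4), of p] assms by simp
qed

lemma conjugate_pow:
  assumes "x \<in> carrier G" "h \<in> carrier G"
  shows "(inv x \<otimes> h \<otimes> x) [^] (i::nat) = inv x \<otimes> h [^] i \<otimes> x"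
  using assms by (induction i) (auto simp: m_assoc)

section \<open>Exponents, orders, centralisers and central subgroups\<close>

lemma pow_cong:
  fixes p :: nat
  assumes "x \<in> carrier G" "x [^] p = \<one>" "i mod p = j mod p"
  shows "x [^] (i::nat) = x [^] (j::nat)"
proof -
  have "x [^] i = x [^] (i mod p)" for i
  proof -
    have "x [^] i = x [^] (p * (i div p) + i mod p)" by simp
    also have "\<dots> = (x [^] p) [^] (i div p) \<otimes> x [^] (i mod p)"
      using assms(1) by (simp only: nat_pow_mult nat_pow_pow)
    finally show ?thesis using assms(1,2) by simp
  qed
  then show ?thesis using assms(3) by metis
qed

lemma ord_eq_prime:
  fixes p :: nat
  assumes "prime p" "x \<in> carrier G" "x [^] p = \<one>" "x \<noteq> \<one>"
  shows "ord x = p"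
  using assms pow_eq_id[of x p] ord_eq_1[of x] by (metis prime_nat_iff)

lemma pow_eq_imp_mod_eq:
  assumes "x \<in> carrier G" "x [^] (i::nat) = x [^] (j::nat)"
  shows "i mod ord x = j mod ord x"
proof -
  have "int (ord x) dvd int i - int j"
    using assms int_pow_eq[of x "int j" "int i"] by (simp add: int_pow_int)
  then show ?thesis
    by (metis mod_eq_dvd_iff of_nat_eq_iff zmod_int)
qed

lemma subgroup_centralizer:
  assumes "X \<subseteq> carrier G"
  shows "subgroup {h \<in> carrier G. \<forall>x\<in>X. h \<otimes> x = x \<otimes> h} G"
proof
  fix h assume h: "h \<in> {h \<in> carrier G. \<forall>x\<in>X. h \<otimes> x = x \<otimes> h}"
  have "inv h \<otimes> x = x \<otimes> inv h" if x: "x \<in> X" for x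
  proof -
    have xc: "x \<in> carrier G" using x assms by auto
    have "h \<otimes> x = x \<otimes> h" using h x by auto
    then have "inv h \<otimes> (h \<otimes> x) \<otimes> inv h = inv h \<otimes> (x \<otimes> h) \<otimes> inv h" by simp
    then show ?thesis using xc h by (simp add: m_assoc)
  qed
  then show "inv h \<in> {h \<in> carrier G. \<forall>x\<in>X. h \<otimes> x = x \<otimes> h}" using h by auto
  fix k assume k: "k \<in> {h \<in> carrier G. \<forall>x\<in>X. h \<otimes> x = x \<otimes> h}"
  have "h \<otimes> k \<otimes> x = x \<otimes> (h \<otimes> k)" if x: "x \<in> X" for x
  proof -
    have xc: "x \<in> carrier G" using x assms by auto
    have hk: "h \<in> carrier G" "k \<in> carrier G" "h \<otimes> x = x \<otimes> h" "k \<otimes> x = x \<otimes> k"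
      using h k x by auto
    then show ?thesis using xc by (metis m_assoc)
  qed
  then show "h \<otimes> k \<in> {h \<in> carrier G. \<forall>x\<in>X. h \<otimes> x = x \<otimes> h}" using h k by auto
qed (use assms in auto)

lemma normal_if_central:
  assumes "subgroup K G" "K \<subseteq> center"
  shows "K \<lhd> G"
proof (rule normal_if_commutators[OF assms(1)])
  fix k x assume "k \<in> K" "x \<in> carrier G"
  then have "commutator k x = \<one>" using assms(2) center_modD by blast
  then show "commutator k x \<in> K" using subgroup.one_closed[OF assms(1)] by simp
qed

text \<open>Since \<open>\<delta> (\<delta> x) = \<one>\<close>, the map \<open>\<delta>\<close> is constant along the orbits of \<open>\<phi>\<close>,
  so \<open>\<phi>\<close> iterated \<open>k\<close> times sends \<open>x\<close> to \<open>x \<otimes> \<delta> x [^] k\<close>.\<close>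

lemma derivation_auto:
  fixes p :: nat
  assumes closed: "\<And>x. x \<in> carrier G \<Longrightarrow> \<delta> x \<in> carrier G"
    and mult: "\<And>x y. x \<in> carrier G \<Longrightarrow> y \<in> carrier G \<Longrightarrow> \<delta> (x \<otimes> y) = inv y \<otimes> \<delta> x \<otimes> y \<otimes> \<delta> y"
    and twice: "\<And>x. x \<in> carrier G \<Longrightarrow> \<delta> (\<delta> x) = \<one>"
    and pow: "\<And>x. x \<in> carrier G \<Longrightarrow> \<delta> x [^] p = \<one>"
    and "prime p" and a: "a \<in> carrier G" "\<delta> a \<noteq> \<one>"
  defines "\<phi> \<equiv> (\<lambda>x\<in>carrier G. x \<otimes> \<delta> x)"
  shows "\<phi> \<in> auto G" and "group.ord (AutoGroup G) \<phi> = p"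
proof -
  have one: "\<delta> \<one> = \<one>"
    using mult[of \<one> \<one>] closed[of \<one>] by simp
  have pow_ker: "\<delta> (\<delta> x [^] (k::nat)) = \<one>" if "x \<in> carrier G" for x k
    using that by (induction k) (simp_all add: one mult twice closed)
  \<comment> \<open>In the product rule, conjugation by \<open>\<delta> x [^] k\<close> fixes
    \<open>\<delta> x\<close>, and \<open>\<delta>\<close> kills
    \<open>\<delta> x [^] k\<close>.\<close>
  have shift: "\<delta> (x \<otimes> \<delta> x [^] k) = \<delta> x" if x: "x \<in> carrier G" for x and k :: nat
  proof -
    have "\<delta> x \<otimes> \<delta> x [^] k = \<delta> x [^] k \<otimes> \<delta> x"
      using closed[OF x] by (metis nat_pow_Suc nat_pow_Suc2)
    then show ?thesis using x closed[OF x] by (simp add: mult pow_ker m_assoc)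
  qed
  \<comment> \<open>As \<open>q = p - 1\<close>, the power \<open>\<delta> x [^] q\<close> is the
    inverse of \<open>\<delta> x\<close>; this yields the inverse map of
    \<open>\<phi>\<close>.\<close>
  obtain q where q: "p = Suc q" using prime_gt_0_nat[OF assms(5)] by (cases p) auto
  have cancel: "x \<otimes> \<delta> x [^] q \<otimes> \<delta> x = x" "x \<otimes> \<delta> x \<otimes> \<delta> x [^] q = x"
    if x: "x \<in> carrier G" for x
  proof -
    have "\<delta> x [^] q \<otimes> \<delta> x = \<one>" using pow[OF x] q by simp
    moreover have "\<delta> x \<otimes> \<delta> x [^] q = \<one>"
      using pow[OF x] q nat_pow_Suc2[OF closed[OF x]] by metis
    ultimately show "x \<otimes> \<delta> x [^] q \<otimes> \<delta> x = x" "x \<otimes> \<delta> x \<otimes> \<delta> x [^] q = x"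
      using x closed[OF x] by (simp_all add: m_assoc)
  qed
  have "bij_betw \<phi> (carrier G) (carrier G)"
    by (rule bij_betw_byWitness[where f' = "\<lambda>x. x \<otimes> \<delta> x [^] q"])
      (use shift[of _ 1] in \<open>auto simp: \<phi>_def closed shift cancel\<close>)
  then have Bij: "\<phi> \<in> Bij (carrier G)" by (simp add: Bij_def \<phi>_def)
  have "\<phi> \<in> hom G G"
    by (auto simp: hom_def \<phi>_def closed mult m_assoc)
  with Bij show auto: "\<phi> \<in> auto G" by (simp add: auto_def)
  interpret A: group "AutoGroup G" by (rule AutoGroup)
  have carr: "carrier (AutoGroup G) = auto G"
    and mult_eq: "f \<otimes>\<^bsub>AutoGroup G\<^esub> g = compose (carrier G) f g"
    if "f \<in> auto G" "g \<in> auto G" for f g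
    using that by (simp_all add: AutoGroup_def BijGroup_def auto_def)
  have one_eq: "\<one>\<^bsub>AutoGroup G\<^esub> = (\<lambda>x\<in>carrier G. x)"
    by (simp add: AutoGroup_def BijGroup_def)
  have c\<phi>: "\<phi> \<in> carrier (AutoGroup G)" using auto carr by blast
  have \<phi>_eq: "\<phi> x = x \<otimes> \<delta> x" if "x \<in> carrier G" for x
    using that by (simp add: \<phi>_def)
  \<comment> \<open>The induction keeps \<open>x\<close> arbitrary: one \<open>\<phi>\<close> is
    applied first, so the hypothesis is used at \<open>x \<otimes> \<delta> x\<close>.\<close>
  have pow_eq: "(\<phi> [^]\<^bsub>AutoGroup G\<^esub> k) x = x \<otimes> \<delta> x [^] k" if "x \<in> carrier G" for k :: nat and x
    using that
  proof (induction k arbitrary: x)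
    case 0
    then show ?case by (simp add: one_eq)
  next
    case (Suc k)
    have "\<phi> [^]\<^bsub>AutoGroup G\<^esub> k \<in> auto G"
      using A.nat_pow_closed[OF c\<phi>] carr auto by blast
    then have "(\<phi> [^]\<^bsub>AutoGroup G\<^esub> Suc k) x = (\<phi> [^]\<^bsub>AutoGroup G\<^esub> k) (\<phi> x)"
      using auto Suc.prems by (simp add: mult_eq compose_def)
    also have "\<dots> = x \<otimes> \<delta> x \<otimes> \<delta> x [^] k"
      using Suc.IH[of "x \<otimes> \<delta> x"] Suc.prems shift[of x 1] closed \<phi>_eq by simp
    finally show ?case
      using Suc.prems closed nat_pow_Suc2[OF closed[OF Suc.prems], of k] by (simp add: m_assoc)
  qed
  have ext: "f \<in> extensional (carrier G)" if "f \<in> carrier (AutoGroup G)" for f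
    using that carr auto by (auto simp: auto_def Bij_def)
  have "\<phi> [^]\<^bsub>AutoGroup G\<^esub> p = \<one>\<^bsub>AutoGroup G\<^esub>"
    by (rule extensionalityI[of _ "carrier G"])
      (use ext A.nat_pow_closed[OF c\<phi>] in \<open>auto simp: pow_eq one_eq pow\<close>)
  moreover have "\<phi> \<noteq> \<one>\<^bsub>AutoGroup G\<^esub>"
  proof
    assume "\<phi> = \<one>\<^bsub>AutoGroup G\<^esub>"
    then have "a \<otimes> \<delta> a = a" using a by (metis \<phi>_def one_eq restrict_apply')
    then show False using a closed by simp
  qed
  ultimately show "group.ord (AutoGroup G) \<phi> = p"
    using A.ord_eq_prime[OF assms(5) c\<phi>] by simp
qed

end

section \<open>Finite p-groups\<close>

locale finite_p_grp = group G for G (structure) +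
  fixes p :: nat
  assumes prime_p: "prime p" and finite_carrier: "finite (carrier G)"
    and order_eq: "\<exists>n. order G = p ^ n"
begin

text \<open>Orbit lengths are powers of \<open>p\<close>. Were \<open>x0\<close> the only fixed
  point, all other orbits in \<open>X\<close> would have length divisible by \<open>p\<close>, and
  \<open>p\<close> would divide both \<open>card X\<close> and \<open>card X - 1\<close>.\<close>

lemma fixed_point:
  assumes "group_action G E \<phi>" "X \<subseteq> E" "finite X"
    and inv: "\<And>g x. g \<in> carrier G \<Longrightarrow> x \<in> X \<Longrightarrow> \<phi> g x \<in> X"
    and "p dvd card X" and x0: "x0 \<in> X" "\<And>g. g \<in> carrier G \<Longrightarrow> \<phi> g x0 = x0"
  shows "\<exists>x\<in>X. x \<noteq> x0 \<and> (\<forall>g\<in>carrier G. \<phi> g x = x)"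
proof (rule ccontr)
  interpret group_action G E \<phi> by fact
  assume neg: "\<not> ?thesis"
  let ?C = "orbit G \<phi> ` (X - {x0})"
  have XE: "x \<in> E" if "x \<in> X" for x using that assms(2) by auto
  have sub: "orbit G \<phi> x \<subseteq> X - {x0}" if x: "x \<in> X - {x0}" for x
  proof
    fix y assume y: "y \<in> orbit G \<phi> x"
    then have "y \<in> X" using inv x by (auto simp: orbit_def)
    moreover have "y \<noteq> x0"
    proof
      assume "y = x0"
      then have "x \<in> orbit G \<phi> x0"
        using y x XE x0 by (intro orbit_sym[of x x0]) auto
      then show False using x x0(2) by (auto simp: orbit_def)
    qed
    ultimately show "y \<in> X - {x0}" by auto
  qed
  have "\<Union>?C = X - {x0}"
    using sub orbit_refl XE by fastforce
  moreover have "p dvd card (\<Union>?C)"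
  proof (rule dvd_partition)
    show "finite (\<Union>?C)" using sub assms(3) by (metis calculation finite_Diff)
    show "\<forall>c\<in>?C. p dvd card c"
    proof
      fix c assume "c \<in> ?C"
      then obtain x where x: "x \<in> X - {x0}" "c = orbit G \<phi> x" by auto
      obtain n where "card c * card (stabilizer G \<phi> x) = p ^ n"
        using orbit_stabilizer_theorem[of x] x XE order_eq by auto
      then obtain i where i: "card c = p ^ i"
        using prime_p by (metis divides_primepow_nat dvd_triv_left)
      have "i \<noteq> 0"
      proof
        assume "i = 0"
        then obtain y where "c = {y}" using i by (auto simp: card_1_singleton_iff)
        moreover have "x \<in> c" using orbit_refl x XE by auto
        ultimately have "\<forall>g\<in>carrier G. \<phi> g x = x"
          using x(2) by (auto simp: orbit_def)
        then show False using neg x by auto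
      qed
      then show "p dvd card c" using i by auto
    qed
    show "\<forall>c1\<in>?C. \<forall>c2\<in>?C. c1 \<noteq> c2 \<longrightarrow> c1 \<inter> c2 = {}"
      using disjoint_union XE by (auto simp: orbits_def)
  qed
  ultimately have "p dvd card X - 1" using x0 assms(3) by simp
  moreover have "card X > 0" using x0 assms(3) card_gt_0_iff by blast
  ultimately have "p dvd 1" using assms(5)
    by (metis One_nat_def Suc_leI dvd_diffD1)
  then show False using prime_p by (simp add: prime_nat_iff)
qed

lemma card_subgroup:
  assumes "subgroup H G"
  shows "\<exists>n. card H = p ^ n"
  using lagrange[OF assms] order_eq divides_primepow_nat[OF prime_p]
  by (metis dvd_triv_right)

lemma finite_subgroup: "subgroup H G \<Longrightarrow> finite H"
  using finite_carrier finite_subset subgroup.subset by blast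

text \<open>Both orders are powers of \<open>p\<close>, so a strict increase is at least a factor
  \<open>p\<close>.\<close>

lemma card_subgroup_growth:
  assumes "subgroup H G" "subgroup K G" "H \<subset> K"
  shows "p * card H \<le> card K"
proof -
  obtain a b where ab: "card H = p ^ a" "card K = p ^ b"
    using card_subgroup assms by metis
  have "card H < card K"
    using assms finite_subgroup psubset_card_mono by blast
  then have "a < b"
    using ab prime_gt_1_nat[OF prime_p] by simp
  then have "p ^ Suc a \<le> p ^ b"
    using prime_gt_0_nat[OF prime_p] by (intro power_increasing) auto
  then show ?thesis using ab by simp
qed

text \<open>Since \<open>order G\<close> is a power of \<open>p\<close>, iterated
  \<open>p\<close>-th powers of \<open>h\<close> reach \<open>\<one>\<close> and hence
  \<open>K\<close>; the last one before the first entry into \<open>K\<close> is the power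
  sought.\<close>

lemma pth_power_step:
  assumes "subgroup K G" "h \<in> carrier G" "h \<notin> K"
  shows "\<exists>k::nat. h [^] k \<notin> K \<and> (h [^] k) [^] p \<in> K"
proof -
  obtain n where "order G = p ^ n" using order_eq by auto
  then have "h [^] (p ^ n) \<in> K"
    using assms pow_order_eq_1[of h] by (simp add: subgroup.one_closed)
  define j where "j = (LEAST j. h [^] (p ^ j) \<in> K)"
  have j: "h [^] (p ^ j) \<in> K"
    unfolding j_def by (rule LeastI) fact
  then have "j \<noteq> 0" using assms by (auto intro: ccontr)
  then obtain i where i: "j = Suc i" by (cases j) auto
  then have "h [^] (p ^ i) \<notin> K"
    using not_less_Least[of i "\<lambda>j. h [^] (p ^ j) \<in> K"] j_def by auto
  moreover have "(h [^] (p ^ i)) [^] p \<in> K"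
    using j i assms by (simp add: nat_pow_pow mult.commute)
  ultimately show ?thesis by blast
qed

text \<open>Conjugation acts on \<open>M\<close>, whose order is divisible by \<open>p\<close>, and
  fixes \<open>\<one>\<close>; a second fixed point is central, and a suitable power of it has order
  \<open>p\<close>.\<close>

lemma normal_meets_center:
  assumes "M \<lhd> G" "M \<noteq> {\<one>}"
  shows "\<exists>z\<in>M. z \<in> center \<and> z \<noteq> \<one> \<and> z [^] p = \<one>"
proof -
  interpret M: normal M G by fact
  have fin: "finite M" using finite_subgroup[OF M.subgroup_axioms] .
  have "{\<one>} \<subset> M" using assms(2) by auto
  then have "card M > 1"
    using fin psubset_card_mono[OF fin \<open>{\<one>} \<subset> M\<close>] by simp
  then have "p dvd card M"
    using card_subgroup[OF M.subgroup_axioms] by (metis dvd_power neq0_conv power_0 less_irrefl)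
  then obtain x where x: "x \<in> M" "x \<noteq> \<one>" "\<forall>g\<in>carrier G. g \<otimes> x \<otimes> inv g = x"
    using fixed_point[OF action_by_conjugation M.subset fin, of \<one>]
    by (auto simp: M.inv_op_closed2)
  have xc: "x \<in> carrier G" using x by auto
  have "g \<otimes> x = x \<otimes> g" if g: "g \<in> carrier G" for g
    using x g xc by (metis inv_solve_right m_closed)
  then have xz: "x \<in> center" using xc by (simp add: mem_center_iff)
  obtain k :: nat where k: "x [^] k \<noteq> \<one>" "(x [^] k) [^] p = \<one>"
    using pth_power_step[OF triv_subgroup xc] x by auto
  moreover have "x [^] k \<in> M" using x M.subgroup_axioms by (induction k) auto
  moreover have "x [^] k \<in> center" by (rule central_pow[OF xz])
  ultimately show ?thesis by blast
qed

text \<open>\<open>G Mod N\<close> is a nontrivial \<open>p\<close>-group, so its centre is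
  nontrivial; a representative of a nontrivial central coset is the new element.\<close>

lemma center_mod_strict:
  assumes "N \<lhd> G" "N \<noteq> carrier G"
  shows "N \<subset> center_mod N"
proof -
  interpret N: normal N G by fact
  interpret Q: finite_p_grp "G Mod N" p
  proof (intro finite_p_grp.intro finite_p_grp_axioms.intro)
    show "group (G Mod N)" by (rule N.factorgroup_is_group)
    have eq: "order (G Mod N) * card N = order G"
      using lagrange[OF N.subgroup_axioms] by (simp add: FactGroup_def order_def)
    then show "\<exists>n. order (G Mod N) = p ^ n"
      using order_eq divides_primepow_nat[OF prime_p] by (metis dvd_triv_left)
    have "order (G Mod N) > 0"
      using eq finite_carrier order_gt_0_iff_finite by (metis gr0I mult_0 less_irrefl)
    then show "finite (carrier (G Mod N))"
      by (simp add: order_def card_gt_0_iff)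
  qed (rule prime_p)
  have "carrier (G Mod N) \<noteq> {\<one>\<^bsub>G Mod N\<^esub>}"
    using assms N.fact_group_trivial_iff[OF finite_carrier] by simp
  then obtain C where C: "C \<in> carrier (G Mod N)" "C \<in> Q.center_mod {\<one>\<^bsub>G Mod N\<^esub>}" "C \<noteq> N"
    using Q.normal_meets_center[of "carrier (G Mod N)"] Q.normal_self
    by (auto simp: one_FactGroup)
  obtain h where h: "h \<in> carrier G" "C = N #> h"
    using C(1) by (auto simp: FactGroup_def RCOSETS_def)
  have "commutator h x \<in> N" if x: "x \<in> carrier G" for x
  proof -
    have "N #> x \<in> carrier (G Mod N)"
      using x by (auto simp: FactGroup_def RCOSETS_def)
    then have "(N #> h) <#> (N #> x) = (N #> x) <#> (N #> h)"
      using Q.center_commute[OF C(2)] h by (simp add: mult_FactGroup)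
    then have "N #> (h \<otimes> x) = N #> (x \<otimes> h)"
      using h x by (simp add: N.rcos_sum)
    then have "h \<otimes> x \<in> N #> (x \<otimes> h)"
      using h x rcos_self[OF _ N.subgroup_axioms, of "h \<otimes> x"] by simp
    then obtain k where "k \<in> N" "h \<otimes> x = k \<otimes> (x \<otimes> h)"
      by (auto simp: r_coset_def)
    then show ?thesis
      using h x commutator_eqI[of h x k] by auto
  qed
  then have "h \<in> center_mod N" using h by (auto simp: center_mod_def)
  moreover have "h \<notin> N" using h C(3) N.rcos_const by auto
  ultimately show ?thesis using normal_subset_center_mod[OF assms(1)] by auto
qed

section \<open>Maximal subgroups and their characters\<close>

definition maximal_subgroup :: "'a set \<Rightarrow> bool" where
  "maximal_subgroup H \<longleftrightarrow> subgroup H G \<and> H \<noteq> carrier G \<and>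
     (\<forall>K. subgroup K G \<longrightarrow> H \<subset> K \<longrightarrow> K = carrier G)"

lemma ex_maximal_subgroup:
  assumes "subgroup K G" "K \<noteq> carrier G"
  shows "\<exists>H. maximal_subgroup H \<and> K \<subseteq> H"
proof -
  define S where "S = {H. subgroup H G \<and> H \<noteq> carrier G}"
  have "finite S"
    unfolding S_def using finite_carrier subgroup.subset
    by (rule_tac B = "Pow (carrier G)" in finite_subset) auto
  moreover have "K \<in> S" using assms by (simp add: S_def)
  ultimately obtain H where H: "H \<in> S" "K \<subseteq> H" "\<And>L. L \<in> S \<Longrightarrow> H \<subseteq> L \<Longrightarrow> H = L"
    using finite_has_maximal2[of S K] by metis
  have "L = carrier G" if "subgroup L G" "H \<subset> L" for L
    using H(3)[of L] that by (auto simp: S_def)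
  then show ?thesis using H by (intro exI[of _ H]) (auto simp: maximal_subgroup_def S_def)
qed

text \<open>Let \<open>N\<close> be a largest normal subgroup of \<open>G\<close> inside
  \<open>H\<close>. Then \<open>center_mod N\<close> is not contained in \<open>H\<close>, yet its
  elements normalise \<open>H\<close> because their commutators lie in \<open>N\<close>. So the
  normaliser of \<open>H\<close> exceeds \<open>H\<close> and is all of \<open>G\<close>.\<close>

lemma maximal_subgroup_normal:
  assumes "maximal_subgroup H"
  obtains a where "H \<lhd> G" "a \<in> carrier G" "a \<notin> H" "a [^] p \<in> H" "adjoin a H = carrier G"
proof -
  have H: "subgroup H G" "H \<noteq> carrier G"
    and max: "\<And>K. subgroup K G \<Longrightarrow> H \<subset> K \<Longrightarrow> K = carrier G"
    using assms by (auto simp: maximal_subgroup_def)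
  interpret H: subgroup H G by (rule H(1))
  define S where "S = {N. N \<lhd> G \<and> N \<subseteq> H}"
  have "finite S"
    unfolding S_def using finite_carrier H.subset
    by (rule_tac B = "Pow (carrier G)" in finite_subset) auto
  moreover have "{\<one>} \<in> S" using one_is_normal by (simp add: S_def)
  ultimately obtain N where "N \<in> S" and NS: "\<And>L. L \<in> S \<Longrightarrow> N \<subseteq> L \<Longrightarrow> N = L"
    using finite_has_maximal2[of S "{\<one>}"] by blast
  then have N: "N \<lhd> G" "N \<subseteq> H" by (simp_all add: S_def)
  have "N \<subset> center_mod N"
    using N H H.subset by (intro center_mod_strict) auto
  then have "\<not> center_mod N \<subseteq> H"
    using NS[of "center_mod N"] normal_center_mod[OF N(1)] by (auto simp: S_def)
  then obtain x where x: "x \<in> center_mod N" "x \<notin> H" by auto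
  then have xc: "x \<in> carrier G" using center_mod_subset by auto
  obtain k :: nat where k: "x [^] k \<notin> H" "(x [^] k) [^] p \<in> H"
    using pth_power_step[OF H(1) xc x(2)] by auto
  define a where "a = x [^] k"
  interpret C: subgroup "center_mod N" G by (rule subgroup_center_mod[OF N(1)])
  have aC: "a \<in> center_mod N"
    unfolding a_def using x by (induction k) auto
  have ac: "a \<in> carrier G" using xc by (simp add: a_def)
  \<comment> \<open>The normaliser; asking for both directions of conjugation makes closure under
    inverses immediate.\<close>
  let ?N = "{g \<in> carrier G. \<forall>h\<in>H. g \<otimes> h \<otimes> inv g \<in> H \<and> inv g \<otimes> h \<otimes> g \<in> H}"
  have conj: "g \<otimes> h \<otimes> inv g \<in> H" if "g \<in> center_mod N" "h \<in> H" for g h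
  proof -
    have gc: "g \<in> carrier G" using that(1) by (rule center_mod_closed)
    have "commutator g h \<in> N" using that by (intro center_modD) auto
    then have "commutator g h \<otimes> h \<in> H"
      using that(2) N(2) by blast
    then show ?thesis
      using that(2) gc by (simp add: commutator_def m_assoc)
  qed
  have "subgroup ?N G"
  proof
    fix g k assume gk: "g \<in> ?N" "k \<in> ?N"
    have "(g \<otimes> k) \<otimes> h \<otimes> inv (g \<otimes> k) = g \<otimes> (k \<otimes> h \<otimes> inv k) \<otimes> inv g"
         "inv (g \<otimes> k) \<otimes> h \<otimes> (g \<otimes> k) = inv k \<otimes> (inv g \<otimes> h \<otimes> g) \<otimes> k" if "h \<in> H" for h
      using gk that by (simp_all add: m_assoc inv_mult_group)
    then show "g \<otimes> k \<in> ?N" using gk by simp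
  qed auto
  moreover have "H \<subseteq> ?N" by auto
  moreover have "a \<in> ?N" using conj[OF aC] conj[OF C.m_inv_closed[OF aC]] ac by auto
  ultimately have "?N = carrier G"
    using max[of ?N] k(1) a_def by blast
  then have norm: "H \<lhd> G" using H(1) by (auto simp: normal_inv_iff)
  have "adjoin a H = carrier G"
    using max[OF subgroup_adjoin[OF ac norm]] subset_adjoin[OF norm] mem_adjoin[OF ac norm] k(1) a_def
    by blast
  then show thesis using that norm ac k a_def by blast
qed

text \<open>\<open>\<chi> x\<close> is an exponent \<open>i\<close> with \<open>x\<close> in the
  coset of \<open>a [^] i\<close> modulo \<open>H\<close>. It is determined only modulo
  \<open>p\<close>, so additivity is expressed by divisibility.\<close>

lemma maximal_subgroup_character:
  assumes "maximal_subgroup H"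
  obtains \<chi> :: "'a \<Rightarrow> int" where
    "\<And>x y. x \<in> carrier G \<Longrightarrow> y \<in> carrier G \<Longrightarrow> int p dvd \<chi> (x \<otimes> y) - (\<chi> x + \<chi> y)"
    "\<And>x. x \<in> carrier G \<Longrightarrow> int p dvd \<chi> x \<longleftrightarrow> x \<in> H"
proof -
  obtain a where norm: "H \<lhd> G" and a: "a \<in> carrier G" "a \<notin> H" "a [^] p \<in> H" "adjoin a H = carrier G"
    using maximal_subgroup_normal[OF assms] .
  interpret H: normal H G by fact
  have dvd: "int p dvd i \<longleftrightarrow> a [^] (i::int) \<in> H" for i
    using a mem_if_prime_pow_mem[OF prime_p H.subgroup_axioms] pow_mod_mem[OF H.subgroup_axioms]
    by blast
  define \<chi> where "\<chi> x = (SOME i::int. inv (a [^] i) \<otimes> x \<in> H)" for x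
  have \<chi>: "inv (a [^] \<chi> x) \<otimes> x \<in> H" if "x \<in> carrier G" for x
  proof -
    have "x \<in> adjoin a H" using that a(4) by simp
    then obtain i :: int and k where "x = a [^] i \<otimes> k" "k \<in> H"
      by (auto simp: adjoin_def)
    then have "inv (a [^] i) \<otimes> x \<in> H" using a by simp
    then show ?thesis unfolding \<chi>_def by (rule someI)
  qed
  show thesis
  proof
    fix x assume x: "x \<in> carrier G"
    let ?k = "inv (a [^] \<chi> x) \<otimes> x"
    have "a [^] \<chi> x \<in> H \<longleftrightarrow> x \<in> H"
    proof
      assume "x \<in> H"
      then have "x \<otimes> inv ?k \<in> H" using \<chi>[OF x] by blast
      then show "a [^] \<chi> x \<in> H" using x a by (simp add: inv_mult_group)
    next
      assume "a [^] \<chi> x \<in> H"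
      then have "a [^] \<chi> x \<otimes> ?k \<in> H" using \<chi>[OF x] by blast
      then show "x \<in> H" using x a by simp
    qed
    then show "int p dvd \<chi> x \<longleftrightarrow> x \<in> H" using dvd by simp
  next
    fix x y assume xy: "x \<in> carrier G" "y \<in> carrier G"
    let ?k = "inv (a [^] \<chi> x) \<otimes> x" and ?l = "inv (a [^] \<chi> y) \<otimes> y"
    let ?m = "inv (a [^] \<chi> (x \<otimes> y)) \<otimes> (x \<otimes> y)"
    have klm: "?k \<in> H" "?l \<in> H" "?m \<in> H" using \<chi> xy by auto
    \<comment> \<open>Combining the three \<open>H\<close>-parts cancels \<open>x\<close> and
      \<open>y\<close> and leaves a power of \<open>a\<close> in \<open>H\<close>, whose exponent is
      the defect of additivity.\<close>
    have "inv (a [^] \<chi> y) \<otimes> ?k \<otimes> a [^] \<chi> y \<in> H"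
      using klm a by (intro H.inv_op_closed1) auto
    then have "inv (a [^] \<chi> y) \<otimes> ?k \<otimes> a [^] \<chi> y \<otimes> ?l \<otimes> inv ?m \<in> H"
      using klm by blast
    also have "inv (a [^] \<chi> y) \<otimes> ?k \<otimes> a [^] \<chi> y \<otimes> ?l \<otimes> inv ?m
        = a [^] (- \<chi> y + (- \<chi> x + \<chi> (x \<otimes> y)))"
      using xy a by (simp only: int_pow_mult[OF a(1)] int_pow_neg[OF a(1)])
        (simp add: m_assoc inv_mult_group)
    finally have "int p dvd - \<chi> y + (- \<chi> x + \<chi> (x \<otimes> y))" by (simp only: dvd)
    then show "int p dvd \<chi> (x \<otimes> y) - (\<chi> x + \<chi> y)" by (simp add: algebra_simps)
  qed
qed

text \<open>For \<open>x\<close> outside \<open>M1\<close>, the cyclic group generated by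
  \<open>x\<close> is proper, so a maximal subgroup \<open>M2\<close> contains it. Neither contains
  the other, hence neither is trivial.\<close>

lemma two_maximal_subgroups:
  assumes "\<not> cyclic_group G"
  obtains M1 M2 where "maximal_subgroup M1" "maximal_subgroup M2"
    "\<not> M1 \<subseteq> M2" "M1 \<noteq> {\<one>}" "M2 \<noteq> {\<one>}"
proof -
  have gen: "generate G {x} \<noteq> carrier G" if "x \<in> carrier G" for x
    using assms that by (auto simp: cyclic_group generate_pow full_SetCompr_eq)
  have "carrier G \<noteq> {\<one>}" using gen[of \<one>] by (auto simp: generate_one)
  then obtain M1 where M1: "maximal_subgroup M1"
    using ex_maximal_subgroup[OF triv_subgroup] by auto
  then obtain x where x: "x \<in> carrier G" "x \<notin> M1"
    by (auto simp: maximal_subgroup_def dest: subgroup.subset)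
  obtain M2 where M2: "maximal_subgroup M2" "generate G {x} \<subseteq> M2"
    using ex_maximal_subgroup[of "generate G {x}"] gen x by (auto intro: generate_is_subgroup)
  have "x \<in> M2" using M2 generate.incl[of x "{x}"] by auto
  then have "\<not> M2 \<subseteq> M1" using x by auto
  moreover from this have "\<not> M1 \<subseteq> M2"
    using M1 M2 by (auto simp: maximal_subgroup_def)
  moreover have "\<one> \<in> M1" "\<one> \<in> M2"
    using M1 M2 by (auto simp: maximal_subgroup_def subgroup.one_closed)
  ultimately have "M1 \<noteq> {\<one>}" "M2 \<noteq> {\<one>}" by auto
  then show thesis using that M1 M2 \<open>\<not> M1 \<subseteq> M2\<close> by blast
qed

end

section \<open>Thin groups all of whose automorphisms of order p are inner\<close>

locale thin_counterexample = finite_p_grp +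
  assumes odd_p: "odd p"
    and thin: "\<And>\<A>. antichain_in G \<A> \<Longrightarrow> card \<A> \<le> p + 1"
    and non_cyclic: "\<not> cyclic_group G"
    and inner: "\<And>\<phi>. \<phi> \<in> auto G \<Longrightarrow> group.ord (AutoGroup G) \<phi> = p \<Longrightarrow> \<phi> \<in> inner_auto G"
begin

lemma p_pos: "p > 0" and p_gt_1: "p > 1"
  using prime_gt_0_nat[OF prime_p] prime_gt_1_nat[OF prime_p] .

text \<open>\<open>derivation_auto\<close> turns \<open>\<delta>\<close> into an automorphism of
  order \<open>p\<close>, which \<open>inner\<close> makes conjugation by some
  \<open>g\<close>.\<close>

lemma inner_derivation:
  assumes closed: "\<And>x. x \<in> carrier G \<Longrightarrow> \<delta> x \<in> carrier G"
    and "\<And>x y. x \<in> carrier G \<Longrightarrow> y \<in> carrier G \<Longrightarrow> \<delta> (x \<otimes> y) = inv y \<otimes> \<delta> x \<otimes> y \<otimes> \<delta> y"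
    and "\<And>x. x \<in> carrier G \<Longrightarrow> \<delta> (\<delta> x) = \<one>"
    and "\<And>x. x \<in> carrier G \<Longrightarrow> \<delta> x [^] p = \<one>"
    and "a \<in> carrier G" "\<delta> a \<noteq> \<one>"
  shows "\<exists>g\<in>carrier G. \<forall>x\<in>carrier G. commutator g x = x \<otimes> \<delta> x \<otimes> inv x"
proof -
  let ?\<phi> = "\<lambda>x\<in>carrier G. x \<otimes> \<delta> x"
  have "?\<phi> \<in> inner_auto G"
    by (intro inner derivation_auto[of \<delta> p a] assms prime_p)
  then obtain g where g: "g \<in> carrier G" and eq: "?\<phi> = (\<lambda>x\<in>carrier G. g \<otimes> x \<otimes> inv g)"
    by (auto simp: inner_auto_def)
  have "commutator g x = x \<otimes> \<delta> x \<otimes> inv x" if x: "x \<in> carrier G" for x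
    using fun_cong[OF eq, of x] x g by (simp add: commutator_def)
  then show ?thesis using g by blast
qed

text \<open>The element \<open>n\<close> induces the central automorphism \<open>x \<mapsto> x z ^ \<chi> x\<close>, where \<open>\<chi>\<close> is a character with
  kernel \<open>M\<close>.\<close>

lemma ex_character_commutator:
  assumes M: "maximal_subgroup M" and z: "z \<in> center" "z \<in> M" "z \<noteq> \<one>" "z [^] p = \<one>"
  obtains n where "n \<in> center_mod (generate G {z})"
    "\<And>x. x \<in> carrier G \<Longrightarrow> commutator n x = \<one> \<longleftrightarrow> x \<in> M"
proof -
  obtain \<chi> :: "'a \<Rightarrow> int" where \<chi>:
    "\<And>x y. x \<in> carrier G \<Longrightarrow> y \<in> carrier G \<Longrightarrow> int p dvd \<chi> (x \<otimes> y) - (\<chi> x + \<chi> y)"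
    "\<And>x. x \<in> carrier G \<Longrightarrow> int p dvd \<chi> x \<longleftrightarrow> x \<in> M"
    using maximal_subgroup_character[OF M] by blast
  interpret C: subgroup center G by (rule subgroup_center_mod[OF one_is_normal])
  interpret M: subgroup M G using M by (simp add: maximal_subgroup_def)
  have zc: "z \<in> carrier G" using z(1) by (rule center_mod_closed)
  have ord: "ord z = p" using ord_eq_prime[OF prime_p zc] z by simp
  have zi: "z [^] (i::int) \<in> center" "z [^] i \<in> M" for i
    using subgroup_int_pow_closed[OF C.subgroup_axioms z(1)]
      subgroup_int_pow_closed[OF M.subgroup_axioms z(2)] by auto
  have z1: "z [^] (i::int) = \<one> \<longleftrightarrow> int p dvd i" for i
    using int_pow_eq_id[OF zc] ord by simp
  obtain a where a: "a \<in> carrier G" "a \<notin> M"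
    using M M.subset by (auto simp: maximal_subgroup_def)
  have "\<exists>n\<in>carrier G. \<forall>x\<in>carrier G. commutator n x = x \<otimes> z [^] \<chi> x \<otimes> inv x"
  proof (rule inner_derivation[of "\<lambda>x. z [^] \<chi> x" a])
    fix x y assume xy: "x \<in> carrier G" "y \<in> carrier G"
    \<comment> \<open>Additivity of \<open>\<chi>\<close> modulo \<open>p\<close> suffices because
      \<open>z\<close> has order \<open>p\<close>; centrality of \<open>z\<close> removes the
      conjugation from the product rule.\<close>
    have "z [^] \<chi> (x \<otimes> y) = z [^] (\<chi> x + \<chi> y)"
      using \<chi>(1)[OF xy] zc ord int_pow_eq by (metis dvd_minus_iff minus_diff_eq)
    then show "z [^] \<chi> (x \<otimes> y) = inv y \<otimes> z [^] \<chi> x \<otimes> y \<otimes> z [^] \<chi> y"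
      using xy zc center_commute[OF zi(1) xy(2)] by (simp add: m_assoc int_pow_mult)
  next
    fix x assume "x \<in> carrier G"
    \<comment> \<open>Powers of \<open>z\<close> lie in \<open>M\<close>, where
      \<open>\<chi>\<close> is divisible by \<open>p\<close>.\<close>
    show "z [^] \<chi> (z [^] \<chi> x) = \<one>"
      using \<chi>(2)[of "z [^] \<chi> x"] z1 zi zc by simp
    have "(z [^] \<chi> x) [^] int p = \<one>"
      using z1[of "\<chi> x * int p"] zc by (simp add: int_pow_pow)
    then show "(z [^] \<chi> x) [^] p = \<one>" by (simp add: int_pow_int)
  qed (use zc a \<chi>(2) z1 in auto)
  then obtain n where n: "n \<in> carrier G"
    "\<And>x. x \<in> carrier G \<Longrightarrow> commutator n x = x \<otimes> z [^] \<chi> x \<otimes> inv x"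
    by blast
  have comm: "commutator n x = z [^] \<chi> x" if x: "x \<in> carrier G" for x
    using n(2)[OF x] x zc by (simp add: m_assoc center_left_commute[OF zi(1)])
  show thesis
  proof
    show "n \<in> center_mod (generate G {z})"
      unfolding center_mod_def generate_pow[OF zc] using n(1) comm by auto
    show "commutator n x = \<one> \<longleftrightarrow> x \<in> M" if "x \<in> carrier G" for x
      using that comm z1 \<chi>(2) by simp
  qed
qed

text \<open>\<open>M\<close> is the centraliser of an element \<open>n\<close>, and every
  centraliser contains the centre.\<close>

lemma center_subset_maximal:
  assumes "maximal_subgroup M" "M \<noteq> {\<one>}"
  shows "center \<subseteq> M"
proof -
  have "M \<lhd> G" using maximal_subgroup_normal[OF assms(1)] by blast
  then obtain z where z: "z \<in> M" "z \<in> center" "z \<noteq> \<one>" "z [^] p = \<one>"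
    using normal_meets_center assms(2) by blast
  obtain n where n: "n \<in> center_mod (generate G {z})"
    "\<And>x. x \<in> carrier G \<Longrightarrow> commutator n x = \<one> \<longleftrightarrow> x \<in> M"
    using ex_character_commutator[OF assms(1) z(2,1,3,4)] by blast
  show ?thesis
  proof
    fix w assume w: "w \<in> center"
    have nc: "n \<in> carrier G" using n(1) by (rule center_mod_closed)
    have "commutator n w = \<one>"
      using w nc by (simp add: mem_center_iff commutator_eq_one_iff)
    then show "w \<in> M" using n(2) center_mod_closed[OF w] by blast
  qed
qed

text \<open>This is \<open>\<Omega>\<^sub>1(Z(G))\<close>.\<close>

definition E :: "'a set" where
  "E = {z \<in> center. z [^] p = \<one>}"

lemma subgroup_E: "subgroup E G"
proof -
  interpret C: subgroup center G by (rule subgroup_center_mod[OF one_is_normal])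
  show ?thesis
  proof
    fix x y assume xy: "x \<in> E" "y \<in> E"
    then have "(x \<otimes> y) [^] p = x [^] p \<otimes> y [^] p"
      by (intro pow_mult_distrib) (auto simp: E_def center_commute)
    then show "x \<otimes> y \<in> E" using xy by (auto simp: E_def)
    show "inv x \<in> E" using xy by (auto simp: E_def nat_pow_inv)
  qed (auto simp: E_def)
qed

lemma E_subset_center: "E \<subseteq> center"
  by (auto simp: E_def)

lemma normal_center: "center \<lhd> G"
  by (rule normal_center_mod[OF one_is_normal])

lemma normal_E: "E \<lhd> G"
  by (rule normal_if_central[OF subgroup_E E_subset_center])

section \<open>The subgroup \<open>P\<close> and its size\<close>

abbreviation P :: "'a set" where
  "P \<equiv> center_mod E"

text \<open>Moving \<open>x\<close> past \<open>h [^] p\<close> costs the \<open>p\<close>-th power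
  of a commutator in \<open>E\<close>, which is trivial.\<close>

lemma P_pow:
  assumes "h \<in> P"
  shows "h [^] p \<in> center"
proof -
  have h: "h \<in> carrier G" using assms by (rule center_mod_closed)
  have "h [^] p \<otimes> x = x \<otimes> h [^] p" if x: "x \<in> carrier G" for x
  proof -
    have e: "commutator h x \<in> center" "commutator h x [^] p = \<one>"
      using center_modD[OF assms x] by (auto simp: E_def)
    show ?thesis
      using pow_mult_commute[OF h x e(1) mult_eq_commutator[OF h x], of p] h x e(2) by simp
  qed
  then show ?thesis using h by (simp add: mem_center_iff)
qed

lemma P_pow_mult:
  assumes "h \<in> P" "k \<in> P"
  shows "(k \<otimes> h) [^] p = k [^] p \<otimes> h [^] p"
proof -
  have h: "h \<in> carrier G" "k \<in> carrier G" using assms center_mod_closed by blast+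
  have "commutator h k \<in> center" "commutator h k [^] p = \<one>"
    using center_modD[OF assms(1) h(2)] by (auto simp: E_def)
  then show ?thesis
    using mult_pow_odd[OF h _ mult_eq_commutator[OF h] odd_p] by blast
qed

lemma subgroup_P: "subgroup P G"
  by (rule subgroup_center_mod[OF normal_E])

lemma P_subset: "P \<subseteq> center_mod center"
  by (rule center_mod_mono[OF E_subset_center])

lemma center_subset_P: "center \<subseteq> P"
  using subgroup.one_closed[OF subgroup_E] by (intro center_mod_mono) simp

lemma card_center_pos: "card center > 0"
  using finite_subgroup[OF normal_imp_subgroup[OF normal_center]]
    subgroup.one_closed[OF normal_imp_subgroup[OF normal_center]] by (auto simp: card_gt_0_iff)

text \<open>Thinness allows at most \<open>p + 1\<close> subgroups \<open>adjoin h center\<close>,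
  each with at most \<open>(p - 1) * card center\<close> elements outside the centre; and
  \<open>(p + 1) * (p - 1) + 1\<close> is the square of \<open>p\<close>.\<close>

lemma card_P_le: "card P \<le> p\<^sup>2 * card center"
proof -
  let ?F = "(\<lambda>h. adjoin h center) ` (P - center)"
  have "card ?F \<le> p + 1"
    using antichain_layer(1)[OF prime_p normal_center _ P_subset P_pow finite_carrier] thin by blast
  have "card P = card (P - center) + card center"
    using center_subset_P finite_subgroup[OF subgroup_P]
    by (metis card_Diff_subset card_mono finite_subset le_add_diff_inverse2)
  also have "card (P - center) \<le> card ?F * ((p - 1) * card center)"
    using antichain_layer(2)[OF prime_p normal_center _ P_subset P_pow finite_carrier] by blast
  also have "\<dots> \<le> (p + 1) * ((p - 1) * card center)"
    using \<open>card ?F \<le> p + 1\<close> by (rule mult_right_mono) simp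
  also have "(p + 1) * ((p - 1) * card center) + card center = p\<^sup>2 * card center"
    using p_pos by (cases p) (auto simp: algebra_simps power2_eq_square)
  finally show ?thesis by simp
qed

text \<open>\<open>center_mod (generate G {z})\<close> already attains the upper bound on
  \<open>card P\<close>; an element of \<open>E\<close> outside \<open>generate G {z}\<close> would
  enlarge \<open>P\<close> by a further factor \<open>p\<close>.\<close>

lemma E_cyclic:
  obtains z where "z \<in> center" "z \<noteq> \<one>" "z [^] p = \<one>" "E = generate G {z}"
    "p\<^sup>2 * card center \<le> card P"
proof -
  obtain M1 M2 where M: "maximal_subgroup M1" "maximal_subgroup M2"
    "\<not> M1 \<subseteq> M2" "M1 \<noteq> {\<one>}" "M2 \<noteq> {\<one>}"
    using two_maximal_subgroups[OF non_cyclic] .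
  have M1: "M1 \<subseteq> carrier G" "M1 \<noteq> carrier G" "M1 \<lhd> G"
    using M(1) maximal_subgroup_normal[OF M(1)] by (auto simp: maximal_subgroup_def dest: subgroup.subset)
  obtain z where z: "z \<in> center" "z \<noteq> \<one>" "z [^] p = \<one>"
    using normal_meets_center[OF M1(3) M(4)] by blast
  have zc: "z \<in> carrier G" using z(1) by (rule center_mod_closed)
  let ?A = "generate G {z}"
  have A: "subgroup ?A G" using zc by (intro generate_is_subgroup) simp
  have AE: "?A \<subseteq> E" using z by (intro generate_subgroup_incl subgroup_E) (simp add: E_def)
  have An: "?A \<lhd> G" using A AE E_subset_center by (intro normal_if_central) auto
  have zM: "z \<in> M1" "z \<in> M2"
    using center_subset_maximal M z(1) by auto
  obtain n1 where n1: "n1 \<in> center_mod ?A" "\<And>x. x \<in> carrier G \<Longrightarrow> commutator n1 x = \<one> \<longleftrightarrow> x \<in> M1"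
    using ex_character_commutator[OF M(1) z(1) zM(1) z(2,3)] by blast
  obtain n2 where n2: "n2 \<in> center_mod ?A" "\<And>x. x \<in> carrier G \<Longrightarrow> commutator n2 x = \<one> \<longleftrightarrow> x \<in> M2"
    using ex_character_commutator[OF M(2) z(1) zM(2) z(2,3)] by blast
  let ?Q = "center_mod ?A"
  \<comment> \<open>The centraliser of \<open>M1\<close> in \<open>?Q\<close>, strictly between the
    centre and \<open>?Q\<close>: \<open>n1\<close> lies in it but is not central, while
    \<open>n2\<close> fails to commute with \<open>b \<in> M1\<close>. Each strict step contributes
    a factor \<open>p\<close>.\<close>
  define R where "R = ?Q \<inter> {h \<in> carrier G. \<forall>x\<in>M1. h \<otimes> x = x \<otimes> h}"
  have Q: "subgroup ?Q G" by (rule subgroup_center_mod[OF An])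
  have R: "subgroup R G"
    unfolding R_def by (intro subgroups_Inter_pair Q subgroup_centralizer M1)
  obtain a where a: "a \<in> carrier G" "a \<notin> M1" using M1 by auto
  obtain b where b: "b \<in> M1" "b \<notin> M2" using M(3) by auto
  have bc: "b \<in> carrier G" using b M1 by auto
  have n1c: "n1 \<in> carrier G" using n1(1) by (rule center_mod_closed)
  have n2c: "n2 \<in> carrier G" using n2(1) by (rule center_mod_closed)
  have "center \<subset> R"
  proof
    have "center \<subseteq> ?Q" using subgroup.one_closed[OF A] by (intro center_mod_mono) auto
    then show "center \<subseteq> R" using M1(1) by (auto simp: R_def mem_center_iff)
    have "n1 \<in> R" using n1 n1c M1(1) by (auto simp: R_def subset_iff commutator_eq_one_iff)
    moreover have "n1 \<notin> center" using n1(2)[OF a(1)] a center_modD[of n1 "{\<one>}" a] by auto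
    ultimately show "center \<noteq> R" by blast
  qed
  then have 1: "p * card center \<le> card R"
    by (intro card_subgroup_growth R normal_imp_subgroup[OF normal_center])
  have "R \<subset> ?Q"
  proof
    show "R \<subseteq> ?Q" by (auto simp: R_def)
    have "n2 \<notin> R" using n2(2)[OF bc] b bc n2c by (auto simp: R_def commutator_eq_one_iff)
    then show "R \<noteq> ?Q" using n2(1) by blast
  qed
  then have 2: "p * card R \<le> card ?Q" by (intro card_subgroup_growth R Q)
  have QP: "?Q \<subseteq> P" by (rule center_mod_mono[OF AE])
  have "p * (p * card center) \<le> p * card R" using 1 by (rule mult_le_mono2)
  then have 3: "p\<^sup>2 * card center \<le> card ?Q"
    using 2 unfolding power2_eq_square mult.assoc by (rule order_trans)
  have "E \<subseteq> ?A"
  proof (rule ccontr)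
    assume "\<not> E \<subseteq> ?A"
    then obtain w where w: "w \<in> E" "w \<notin> ?A" by auto
    then have w': "w \<in> center" "w [^] p = \<one>" by (auto simp: E_def)
    have wc: "w \<in> carrier G" using w'(1) by (rule center_mod_closed)
    have w1: "w \<noteq> \<one>" using w subgroup.one_closed[OF A] by auto
    have "w \<in> M1" using center_subset_maximal M w' by auto
    \<comment> \<open>All commutators of \<open>n3\<close> are powers of \<open>w\<close>. One of
      them is nontrivial, and if it lay in \<open>?A\<close> then so would \<open>w\<close>; hence
      \<open>n3\<close> is in \<open>P\<close> but not in \<open>?Q\<close>.\<close>
    then obtain n3 where n3: "n3 \<in> center_mod (generate G {w})"
        "\<And>x. x \<in> carrier G \<Longrightarrow> commutator n3 x = \<one> \<longleftrightarrow> x \<in> M1"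
      using ex_character_commutator[OF M(1) w'(1) _ w1 w'(2)] by blast
    have "generate G {w} \<subseteq> E" using w by (intro generate_subgroup_incl subgroup_E) auto
    then have "n3 \<in> P" using n3(1) center_mod_mono by blast
    moreover have "n3 \<notin> ?Q"
    proof
      assume "n3 \<in> ?Q"
      then have "commutator n3 a \<in> ?A" using a by (intro center_modD)
      moreover have "commutator n3 a \<in> generate G {w}" using a n3(1) by (intro center_modD)
      then obtain i :: int where i: "commutator n3 a = w [^] i"
        using wc by (auto simp: generate_pow)
      moreover have "commutator n3 a \<noteq> \<one>" using n3(2) a by auto
      then have "\<not> int p dvd i"
        using i int_pow_eq_id[OF wc] ord_eq_prime[OF prime_p wc w'(2) w1] by simp
      ultimately show False
        using mem_if_prime_pow_mem[OF prime_p A wc] w'(2) w(2) subgroup.one_closed[OF A] by auto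
    qed
    ultimately have "?Q \<subset> P" using QP by blast
    then have "p * card ?Q \<le> card P" by (intro card_subgroup_growth Q subgroup_P)
    then have "p * (p\<^sup>2 * card center) \<le> p\<^sup>2 * card center"
      using mult_le_mono2[OF 3, of p] card_P_le by linarith
    then show False using p_gt_1 card_center_pos by simp
  qed
  then have "E = ?A" using AE by auto
  moreover have "card ?Q \<le> card P"
    using QP finite_subgroup[OF subgroup_P] by (intro card_mono)
  ultimately show thesis using that z 3 by auto
qed

text \<open>The \<open>p\<close>-th power map \<open>P \<rightarrow> center\<close> is a homomorphism, and \<open>P\<close> is too large for its kernel
  to be contained in \<open>E\<close>.\<close>

lemma ex_noncentral_prime_element:
  obtains n where "n \<in> P" "n \<notin> center" "n [^] p = \<one>"
proof (rule ccontr)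
  assume "\<not> thesis"
  \<comment> \<open>If no such \<open>n\<close> exists, every element of \<open>P\<close> with
    trivial \<open>p\<close>-th power is central.\<close>
  then have neg: "v \<in> E" if "v \<in> P" "v [^] p = \<one>" for v
    using that \<open>\<And>n. \<lbrakk>n \<in> P; n \<notin> center; n [^] p = \<one>\<rbrakk> \<Longrightarrow> thesis\<close> by (auto simp: E_def)
  obtain z where z: "z \<in> center" "z \<noteq> \<one>" "z [^] p = \<one>" "E = generate G {z}"
    "p\<^sup>2 * card center \<le> card P"
    using E_cyclic by blast
  have zc: "z \<in> carrier G" using z(1) by (rule center_mod_closed)
  have cE: "card E = p"
    using generate_pow_card[OF zc] ord_eq_prime[OF prime_p zc z(3,2)] z(4) by simp
  interpret P: subgroup P G by (rule subgroup_P)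
  have fin: "finite P" "finite E" "finite center"
    using finite_subgroup subgroup_P subgroup_E normal_imp_subgroup[OF normal_center] by auto
  let ?I = "(\<lambda>v. v [^] p) ` P"
  have fibre: "card {v \<in> P. v [^] p = y} \<le> p" if y: "y \<in> ?I" for y
  proof -
    obtain u where u: "u \<in> P" "u [^] p = y" using y by auto
    have uc: "u \<in> carrier G" using u by simp
    \<comment> \<open>Translating by the inverse of a member \<open>u\<close> sends the fibre of the
      power map into its kernel, which lies in \<open>E\<close>.\<close>
    have "(\<lambda>v. inv u \<otimes> v) ` {v \<in> P. v [^] p = y} \<subseteq> E"
    proof safe
      fix v assume v: "v \<in> P" "y = v [^] p"
      have "(inv u \<otimes> v) [^] p = inv u [^] p \<otimes> v [^] p"
        using u v by (intro P_pow_mult) auto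
      then show "inv u \<otimes> v \<in> E"
        using u v uc by (intro neg) (auto simp: nat_pow_inv)
    qed
    moreover have "inj_on (\<lambda>v. inv u \<otimes> v) {v \<in> P. v [^] p = y}"
      using uc by (auto simp: inj_on_def)
    ultimately show ?thesis using card_inj_on_le[OF _ _ fin(2)] cE by metis
  qed
  have "P = (\<Union>y\<in>?I. {v \<in> P. v [^] p = y})" by auto
  then have "card P \<le> (\<Sum>y\<in>?I. card {v \<in> P. v [^] p = y})"
    using card_UN_le[of ?I "\<lambda>y. {v \<in> P. v [^] p = y}"] fin by simp
  also have "\<dots> \<le> (\<Sum>y\<in>?I. p)" by (intro sum_mono fibre)
  also have "\<dots> = card ?I * p" by simp
  also have "card ?I \<le> card center"
    using fin P_pow by (intro card_mono) auto
  finally have "card P \<le> card center * p" by simp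
  then have "p\<^sup>2 * card center \<le> card center * p" by (rule order_trans[OF z(5)])
  then show False using p_gt_1 card_center_pos by (simp add: power2_eq_square)
qed

section \<open>Elements central modulo \<open>adjoin n E\<close>\<close>

lemma adjoin_E_pow:
  assumes n: "n \<in> P" "n [^] p = \<one>" and k: "k \<in> adjoin n E"
  shows "k [^] p = \<one>"
proof -
  have nc: "n \<in> carrier G" using n(1) by (rule center_mod_closed)
  obtain i :: int and e where k: "k = n [^] i \<otimes> e" and "e \<in> E"
    using k by (auto simp: adjoin_def)
  then have e: "e \<in> center" "e [^] p = \<one>" by (auto simp: E_def)
  have ec: "e \<in> carrier G" using e(1) by (rule center_mod_closed)
  have "(n [^] i) [^] p = (n [^] p) [^] i"
    using nc by (metis int_pow_int int_pow_pow mult.commute)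
  moreover have "k [^] p = (n [^] i) [^] p \<otimes> e [^] p"
    unfolding k using nc ec center_commute[OF e(1), of "n [^] i"] by (intro pow_mult_distrib) auto
  ultimately show ?thesis using n(2) e(2) by simp
qed

lemma adjoin_E_subset_P: "n \<in> P \<Longrightarrow> adjoin n E \<subseteq> P"
  by (rule adjoin_least[OF subgroup_P _ order_trans[OF E_subset_center center_subset_P]])

text \<open>A conjugate of \<open>h\<close> has the form \<open>k \<otimes> h\<close> with
  \<open>k\<close> in \<open>adjoin n E\<close>. Here \<open>k [^] p = \<one>\<close> and
  \<open>commutator h k\<close> lies in \<open>E\<close> because \<open>k \<in> P\<close>, so
  \<open>mult_pow_odd\<close> shows that conjugation leaves \<open>h [^] p\<close>
  unchanged.\<close>

lemma center_mod_adjoin_pow: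
  assumes n: "n \<in> P" "n [^] p = \<one>" and h: "h \<in> center_mod (adjoin n E)"
  shows "h [^] p \<in> center"
proof -
  have hc: "h \<in> carrier G" using h by (rule center_mod_closed)
  have "h [^] p \<otimes> x = x \<otimes> h [^] p" if x: "x \<in> carrier G" for x
  proof -
    define k where "k = inv x \<otimes> commutator h x \<otimes> x"
    have k: "k \<in> adjoin n E"
      unfolding k_def using x center_modD[OF h x]
      by (intro normal.inv_op_closed1[OF normal_adjoin[OF normal_E n(1)]])
    then have kP: "k \<in> P" using adjoin_E_subset_P[OF n(1)] by auto
    have kc: "k \<in> carrier G" using kP by (rule center_mod_closed)
    have "commutator k h \<in> E" using kP hc by (rule center_modD)
    moreover have "commutator h k = inv (commutator k h)"
      using hc kc by (simp add: commutator_def inv_mult_group m_assoc)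
    ultimately have "commutator h k \<in> E" using subgroup.m_inv_closed[OF subgroup_E] by simp
    then have e: "commutator h k \<in> center" "commutator h k [^] p = \<one>" by (auto simp: E_def)
    have "inv x \<otimes> h [^] p \<otimes> x = (inv x \<otimes> h \<otimes> x) [^] p"
      using x hc by (simp add: conjugate_pow)
    also have "inv x \<otimes> h \<otimes> x = k \<otimes> h"
      using x hc by (simp add: k_def commutator_def m_assoc)
    also have "(k \<otimes> h) [^] p = h [^] p"
      using mult_pow_odd[OF hc kc e(1) mult_eq_commutator[OF hc kc] odd_p e(2)]
        adjoin_E_pow[OF n k] hc by simp
    finally have "x \<otimes> (inv x \<otimes> h [^] p \<otimes> x) = x \<otimes> h [^] p" by simp
    then show ?thesis using x hc by (simp add: m_assoc)
  qed
  then show ?thesis using hc by (simp add: mem_center_iff)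
qed

text \<open>Write \<open>[n, x] = z ^ \<iota> x\<close>. The derivation \<open>\<delta> x = n ^ \<iota> x z ^ (t (\<iota> x)\<^sup>2)\<close>, with \<open>t\<close> an inverse of
  \<open>2\<close> modulo \<open>p\<close>, defines an automorphism of order \<open>p\<close>; \<open>g\<close> is an element inducing it.\<close>

lemma ex_new_central_mod_adjoin:
  assumes n: "n \<in> P" "n \<notin> center" "n [^] p = \<one>"
  shows "\<exists>g. g \<in> center_mod (adjoin n E) \<and> g \<notin> P"
proof -
  obtain z where z: "z \<in> center" "z \<noteq> \<one>" "z [^] p = \<one>" and E_gen: "E = generate G {z}"
    using E_cyclic by blast
  have nc: "n \<in> carrier G" using n(1) by (rule center_mod_closed)
  have zc: "z \<in> carrier G" using z(1) by (rule center_mod_closed)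
  have ord_z: "ord z = p" using ord_eq_prime[OF prime_p zc z(3,2)] .
  have zpow: "z [^] (k::nat) \<in> center" "z [^] k \<in> E" for k
    using central_pow[OF z(1)]
    by (auto simp: E_gen generate_pow[OF zc] simp flip: int_pow_int)
  let ?N = "adjoin n E"
  have N: "?N \<lhd> G" by (rule normal_adjoin[OF normal_E n(1)])

  have "\<exists>i::nat. n \<otimes> x = z [^] i \<otimes> (x \<otimes> n)" if x: "x \<in> carrier G" for x
  proof -
    have "commutator n x \<in> generate G {z}" using center_modD[OF n(1) x] E_gen by simp
    then obtain i :: nat where "commutator n x = z [^] i"
      using generate_pow_on_finite_carrier[OF finite_carrier zc] by auto
    then show ?thesis using mult_eq_commutator[OF nc x] by auto
  qed
  \<comment> \<open>The exponents are chosen arbitrarily; only their residues modulo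
    \<open>p\<close> are determined, and on these \<open>\<iota>\<close> is additive.\<close>
  then obtain \<iota> :: "'a \<Rightarrow> nat" where \<iota>:
    "\<And>x. x \<in> carrier G \<Longrightarrow> n \<otimes> x = z [^] \<iota> x \<otimes> (x \<otimes> n)"
    by metis
  have \<iota>_unique: "\<iota> x mod p = i mod p"
    if "x \<in> carrier G" "n \<otimes> x = z [^] i \<otimes> (x \<otimes> n)" for x i
  proof -
    have "z [^] \<iota> x \<otimes> (x \<otimes> n) = z [^] i \<otimes> (x \<otimes> n)" using \<iota>[OF that(1)] that(2) by simp
    then have "z [^] \<iota> x = z [^] i" using that(1) nc zc by simp
    then show ?thesis using pow_eq_imp_mod_eq[OF zc, of "\<iota> x" i] ord_z by simp
  qed
  have \<iota>_mult: "\<iota> (x \<otimes> y) mod p = (\<iota> x + \<iota> y) mod p"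
    if xy: "x \<in> carrier G" "y \<in> carrier G" for x y
  proof (rule \<iota>_unique)
    have "n \<otimes> (x \<otimes> y) = (n \<otimes> x) \<otimes> y"
      using xy nc by (simp add: m_assoc)
    also have "\<dots> = z [^] \<iota> x \<otimes> (x \<otimes> (n \<otimes> y))"
      unfolding \<iota>[OF xy(1)] using xy nc zc by (simp add: m_assoc)
    also have "\<dots> = z [^] \<iota> x \<otimes> (z [^] \<iota> y \<otimes> (x \<otimes> (y \<otimes> n)))"
      unfolding \<iota>[OF xy(2)] using xy nc zc by (simp add: center_left_commute[OF zpow(1) xy(1)])
    also have "\<dots> = z [^] (\<iota> x + \<iota> y) \<otimes> (x \<otimes> y \<otimes> n)"
      using xy nc zc by (simp add: m_assoc flip: nat_pow_mult)
    finally show "n \<otimes> (x \<otimes> y) = z [^] (\<iota> x + \<iota> y) \<otimes> (x \<otimes> y \<otimes> n)" .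
  qed (use xy in auto)
  have \<iota>_0: "\<iota> x mod p = 0" if "x \<in> carrier G" "n \<otimes> x = x \<otimes> n" for x
    using \<iota>_unique[of x 0] that nc by simp

  define t where "t = (p + 1) div 2"
  have t: "2 * t = p + 1" using odd_p by (auto simp: t_def elim!: oddE)
  define \<delta> where "\<delta> x = n [^] \<iota> x \<otimes> z [^] (t * (\<iota> x)\<^sup>2)" for x
  \<comment> \<open>\<open>n\<close> and \<open>z\<close> have trivial \<open>p\<close>-th powers,
    so \<open>\<delta> x\<close> depends only on \<open>\<iota> x\<close> modulo
    \<open>p\<close>.\<close>
  have \<delta>_cong: "\<delta> x = n [^] i \<otimes> z [^] (t * i\<^sup>2)" if "\<iota> x mod p = i mod p" for x i
  proof -
    have "n [^] \<iota> x = n [^] i" by (rule pow_cong[OF nc n(3) that])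
    moreover have "(t * (\<iota> x)\<^sup>2) mod p = (t * i\<^sup>2) mod p"
      using that by (metis mod_mult_right_eq power_mod)
    then have "z [^] (t * (\<iota> x)\<^sup>2) = z [^] (t * i\<^sup>2)" by (rule pow_cong[OF zc z(3)])
    ultimately show ?thesis by (simp add: \<delta>_def)
  qed
  have \<delta>_closed: "\<delta> x \<in> carrier G" for x using nc zc by (simp add: \<delta>_def)
  have \<delta>_N: "\<delta> x \<in> ?N" for x
  proof -
    have "\<delta> x = n [^] int (\<iota> x) \<otimes> z [^] (t * (\<iota> x)\<^sup>2)" by (simp add: \<delta>_def int_pow_int)
    then show ?thesis unfolding adjoin_def using zpow(2) by blast
  qed
  obtain a where a: "a \<in> carrier G" "n \<otimes> a \<noteq> a \<otimes> n"
    using n(2) nc by (auto simp: mem_center_iff)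
  have \<iota>a: "\<not> p dvd \<iota> a"
  proof
    assume "p dvd \<iota> a"
    then have "z [^] \<iota> a = \<one>" using pow_eq_id[OF zc] ord_z by simp
    then show False using \<iota>[OF a(1)] a nc by simp
  qed
  \<comment> \<open>Needed twice: it makes \<open>\<delta> a\<close> nontrivial, and later it keeps
    \<open>g\<close> out of \<open>P\<close>.\<close>
  have \<delta>a: "\<delta> a \<notin> E"
  proof
    assume "\<delta> a \<in> E"
    then have "\<delta> a \<otimes> inv (z [^] (t * (\<iota> a)\<^sup>2)) \<in> E" using zpow(2) subgroup.m_closed[OF subgroup_E] subgroup.m_inv_closed[OF subgroup_E] by blast
    then have "n [^] \<iota> a \<in> E" using nc zc by (simp add: \<delta>_def m_assoc)
    then have "n \<in> E"
      using mem_if_prime_pow_mem[OF prime_p subgroup_E nc, of "int (\<iota> a)"] n(3) \<iota>a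
        subgroup.one_closed[OF subgroup_E] by (simp add: int_pow_int)
    then show False using n(2) E_subset_center by auto
  qed
  have "\<exists>g\<in>carrier G. \<forall>x\<in>carrier G. commutator g x = x \<otimes> \<delta> x \<otimes> inv x"
  proof (rule inner_derivation[of \<delta> a])
    fix x assume x: "x \<in> carrier G"
    show "\<delta> x \<in> carrier G" by (rule \<delta>_closed)
    show "\<delta> x [^] p = \<one>" by (rule adjoin_E_pow[OF n(1,3) \<delta>_N])
    \<comment> \<open>\<open>\<iota>\<close> vanishes modulo \<open>p\<close> on the centraliser of
      \<open>n\<close>, which contains the values of \<open>\<delta>\<close>; hence
      \<open>\<delta>\<close> is trivial on its own values.\<close>
    have "n \<otimes> \<delta> x = \<delta> x \<otimes> n"
    proof -
      have "n \<otimes> \<delta> x = (n \<otimes> n [^] \<iota> x) \<otimes> z [^] (t * (\<iota> x)\<^sup>2)"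
        using nc zc by (simp add: \<delta>_def m_assoc)
      also have "n \<otimes> n [^] \<iota> x = n [^] \<iota> x \<otimes> n"
        using nc by (metis nat_pow_Suc nat_pow_Suc2)
      finally show ?thesis
        using nc zc center_commute[OF zpow(1) nc] by (simp add: \<delta>_def m_assoc)
    qed
    then have "\<iota> (\<delta> x) mod p = 0 mod p" using \<iota>_0[OF \<delta>_closed] by simp
    then show "\<delta> (\<delta> x) = \<one>" using \<delta>_cong[of "\<delta> x" 0] by simp
  next
    fix x y assume xy: "x \<in> carrier G" "y \<in> carrier G"
    let ?i = "\<iota> x" and ?j = "\<iota> y"
    have zs: "z [^] (k::nat) \<in> carrier G" for k using zc by simp
    have nz: "z [^] k \<otimes> n [^] m = n [^] m \<otimes> z [^] k"
      "w \<in> carrier G \<Longrightarrow> z [^] k \<otimes> (n [^] m \<otimes> w) = n [^] m \<otimes> (z [^] k \<otimes> w)" for k m :: nat and w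
      using nc center_commute[OF zpow(1)] center_left_commute[OF zpow(1)] by simp_all
    \<comment> \<open>Conjugating \<open>n [^] \<iota> x\<close> by \<open>y\<close> produces the
      cross term \<open>z [^] (\<iota> y * \<iota> x)\<close>.\<close>
    have "inv y \<otimes> \<delta> x \<otimes> y = inv y \<otimes> (n [^] ?i \<otimes> y) \<otimes> z [^] (t * ?i\<^sup>2)"
      using xy nc zs center_commute[OF zpow(1) xy(2)] by (simp add: \<delta>_def m_assoc)
    also have "n [^] ?i \<otimes> y = (z [^] ?j) [^] ?i \<otimes> (y \<otimes> n [^] ?i)"
      by (rule pow_mult_commute[OF nc xy(2) zpow(1) \<iota>[OF xy(2)]])
    also have "inv y \<otimes> ((z [^] ?j) [^] ?i \<otimes> (y \<otimes> n [^] ?i)) = z [^] (?j * ?i) \<otimes> n [^] ?i"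
      using xy nc zs center_left_commute[OF zpow(1), of "inv y" "y \<otimes> n [^] ?i"] by (simp add: nat_pow_pow zc)
    finally have "inv y \<otimes> \<delta> x \<otimes> y \<otimes> \<delta> y
        = z [^] (?j * ?i) \<otimes> n [^] ?i \<otimes> z [^] (t * ?i\<^sup>2) \<otimes> (n [^] ?j \<otimes> z [^] (t * ?j\<^sup>2))"
      by (simp add: \<delta>_def)
    also have "\<dots> = n [^] (?i + ?j) \<otimes> z [^] (?j * ?i + (t * ?i\<^sup>2 + t * ?j\<^sup>2))"
      using nc zs nz
      by (simp add: m_assoc zc flip: nat_pow_mult)
    \<comment> \<open>Expanding the square yields the cross term with coefficient
      \<open>2 * t = p + 1\<close>, which is 1 modulo \<open>p\<close>; this is why the quadratic
      correction is part of \<open>\<delta>\<close>.\<close>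
    also have "z [^] (?j * ?i + (t * ?i\<^sup>2 + t * ?j\<^sup>2)) = z [^] (t * (?i + ?j)\<^sup>2)"
    proof (rule pow_cong[OF zc z(3)])
      have "t * (?i + ?j)\<^sup>2 = (2 * t) * (?j * ?i) + (t * ?i\<^sup>2 + t * ?j\<^sup>2)"
        by (simp add: power2_eq_square algebra_simps)
      also have "\<dots> = p * (?j * ?i) + (?j * ?i + (t * ?i\<^sup>2 + t * ?j\<^sup>2))"
        by (simp add: t)
      finally show "(?j * ?i + (t * ?i\<^sup>2 + t * ?j\<^sup>2)) mod p = (t * (?i + ?j)\<^sup>2) mod p"
        by simp
    qed
    also have "n [^] (?i + ?j) \<otimes> z [^] (t * (?i + ?j)\<^sup>2) = \<delta> (x \<otimes> y)"
      using \<delta>_cong[OF \<iota>_mult[OF xy]] by simp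
    finally show "\<delta> (x \<otimes> y) = inv y \<otimes> \<delta> x \<otimes> y \<otimes> \<delta> y" by simp
  next
    show "\<delta> a \<noteq> \<one>" using \<delta>a subgroup.one_closed[OF subgroup_E] by auto
  qed (rule a(1))
  then obtain g where g: "g \<in> carrier G"
    and g_comm: "\<And>x. x \<in> carrier G \<Longrightarrow> commutator g x = x \<otimes> \<delta> x \<otimes> inv x"
    by blast

  \<comment> \<open>Commutators of \<open>g\<close> are conjugates of values of
    \<open>\<delta>\<close>, and these values lie in the normal subgroup \<open>?N\<close>.\<close>
  have gR: "g \<in> center_mod ?N"
    unfolding center_mod_def using g g_comm normal.inv_op_closed2[OF N _ \<delta>_N] by simp
  have gP: "g \<notin> P"
  proof
    assume "g \<in> P"
    then have "a \<otimes> \<delta> a \<otimes> inv a \<in> E" using center_modD[of g E a] g_comm a by simp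
    then have "inv a \<otimes> (a \<otimes> \<delta> a \<otimes> inv a) \<otimes> a \<in> E" using a(1) by (intro normal.inv_op_closed1[OF normal_E])
    then show False using \<delta>a a \<delta>_closed by (simp add: m_assoc)
  qed

  show ?thesis using gR gP by blast
qed

section \<open>The antichain with at least \<open>2 * p\<close> members\<close>

lemma contradiction: False
proof -
  obtain n where n: "n \<in> P" "n \<notin> center" "n [^] p = \<one>"
    by (rule ex_noncentral_prime_element)
  have card_P: "p\<^sup>2 * card center \<le> card P"
    using E_cyclic by blast
  have nc: "n \<in> carrier G" using n(1) by (rule center_mod_closed)
  \<comment> \<open>Built from \<open>adjoin n E\<close> rather than from the larger
    \<open>N\<close> below, because \<open>center_mod_adjoin_pow\<close> uses that its elements have
    trivial \<open>p\<close>-th powers.\<close>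
  define R where "R = center_mod (adjoin n E)"
  obtain g where g: "g \<in> R" "g \<notin> P"
    using ex_new_central_mod_adjoin[OF n] by (auto simp: R_def)
  have N0: "adjoin n E \<lhd> G" by (rule normal_adjoin[OF normal_E n(1)])
  have R: "subgroup R G" unfolding R_def by (rule subgroup_center_mod[OF N0])
  have "P \<subseteq> R" unfolding R_def by (rule center_mod_mono[OF subset_adjoin[OF normal_E]])
  define N where "N = adjoin n center"
  have n_center: "n \<in> center_mod center" using n(1) P_subset by auto
  have N: "N \<lhd> G" unfolding N_def by (rule normal_adjoin[OF normal_center n_center])
  have "center \<subseteq> N" unfolding N_def by (rule subset_adjoin[OF normal_center])
  have "N \<subseteq> P" unfolding N_def by (rule adjoin_least[OF subgroup_P n(1) center_subset_P])
  have "adjoin n E \<subseteq> N" using E_subset_center by (auto simp: N_def adjoin_def)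
  then have "R \<subseteq> center_mod N" unfolding R_def by (rule center_mod_mono)
  let ?A = "(\<lambda>h. adjoin h center) ` (P - N)" and ?B = "(\<lambda>h. adjoin h N) ` (R - P)"
  have R_powN: "h [^] p \<in> N" if "h \<in> R" for h
    using center_mod_adjoin_pow[OF n(1,3)] that \<open>center \<subseteq> N\<close> by (auto simp: R_def)
  have fin: "finite P" "finite N" "finite R" "finite center"
    using finite_subgroup R subgroup_P normal_imp_subgroup[OF N] normal_imp_subgroup[OF normal_center] by auto
  note A = antichain_layer[OF prime_p normal_center \<open>center \<subseteq> N\<close> P_subset P_pow finite_carrier]
  note B = antichain_layer[OF prime_p N \<open>N \<subseteq> P\<close> \<open>R \<subseteq> center_mod N\<close> R_powN finite_carrier]
  have card_N: "card N \<le> p * card center"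
    unfolding N_def using n(3) by (intro card_adjoin_le p_pos normal_center fin nc) (simp add: subgroup.one_closed[OF normal_imp_subgroup[OF normal_center]])
  have pP: "p * card N \<le> card P"
    using mult_le_mono2[OF card_N, of p] card_P unfolding power2_eq_square mult.assoc
    by (rule order_trans)
  \<comment> \<open>\<open>P - N\<close> has at least \<open>p * (p - 1)\<close> times as many
    elements as the centre.\<close>
  have "p * ((p - 1) * card center) \<le> card ?A * ((p - 1) * card center)"
  proof -
    have "p * ((p - 1) * card center) = p\<^sup>2 * card center - p * card center"
      by (simp add: power2_eq_square algebra_simps diff_mult_distrib)
    also have "\<dots> \<le> card P - card N" using card_N card_P by linarith
    also have "\<dots> = card (P - N)" using \<open>N \<subseteq> P\<close> fin by (simp add: card_Diff_subset)
    finally show ?thesis using A(2) by linarith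
  qed
  then have cA: "p \<le> card ?A" using p_gt_1 card_center_pos by simp
  \<comment> \<open>As \<open>g\<close> makes \<open>R\<close> strictly larger than
    \<open>P\<close>, \<open>R - P\<close> has at least \<open>p - 1\<close> times as many elements
    as \<open>P\<close>, and \<open>P\<close> at least \<open>p\<close> times as many as
    \<open>N\<close>.\<close>
  have "p * ((p - 1) * card N) \<le> card ?B * ((p - 1) * card N)"
  proof -
    have "p * card P \<le> card R"
      using g \<open>P \<subseteq> R\<close> by (intro card_subgroup_growth subgroup_P R) auto
    then have "(p - 1) * card P \<le> card (R - P)"
      using \<open>P \<subseteq> R\<close> fin by (simp add: card_Diff_subset diff_mult_distrib)
    moreover have "p * ((p - 1) * card N) \<le> (p - 1) * card P"
      using mult_le_mono2[OF pP, of "p - 1"] by (simp add: ac_simps)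
    ultimately show ?thesis using B(2) by linarith
  qed
  moreover have "card N > 0"
    using card_center_pos card_mono[OF fin(2) \<open>center \<subseteq> N\<close>] by linarith
  ultimately have cB: "p \<le> card ?B" using p_gt_1 by simp

  \<comment> \<open>Otherwise the exchange property over \<open>N\<close> puts \<open>k\<close> into
    \<open>adjoin h N\<close>, which lies in \<open>P\<close>.\<close>
  have AB: "\<not> adjoin h center \<subseteq> adjoin k N" if h: "h \<in> P - N" and k: "k \<in> R - P" for h k
  proof
    have hc: "h \<in> carrier G" using h center_mod_closed by blast
    have kc: "k \<in> carrier G" using k subgroup.mem_carrier[OF R] by blast
    assume "adjoin h center \<subseteq> adjoin k N"
    then have "h \<in> adjoin k N" using mem_adjoin[OF hc normal_center] by auto
    then have "k \<in> adjoin h N"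
      using h k hc kc by (intro adjoin_exchange[OF prime_p N hc kc R_powN]) auto
    moreover have "adjoin h N \<subseteq> P" using h \<open>N \<subseteq> P\<close> by (intro adjoin_least subgroup_P) auto
    ultimately show False using k by auto
  qed
  have BA: "\<not> adjoin k N \<subseteq> adjoin h center" if h: "h \<in> P - N" and k: "k \<in> R - P" for h k
  proof
    have kc: "k \<in> carrier G" using k subgroup.mem_carrier[OF R] by blast
    assume "adjoin k N \<subseteq> adjoin h center"
    moreover have "adjoin h center \<subseteq> P" using h by (intro adjoin_least subgroup_P center_subset_P) auto
    ultimately show False using mem_adjoin[OF kc N] k by auto
  qed
  have incomparable: "\<not> K \<subseteq> L \<and> \<not> L \<subseteq> K" if K: "K \<in> ?A" and L: "L \<in> ?B" for K L
  proof -
    obtain h where h: "h \<in> P - N" "K = adjoin h center" using K by auto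
    obtain k where k: "k \<in> R - P" "L = adjoin k N" using L by auto
    show ?thesis unfolding h(2) k(2) using AB BA h(1) k(1) by simp
  qed
  have "antichain_in G (?A \<union> ?B)"
    by (rule antichain_in_Un[OF A(1) B(1) incomparable])
  then have "card (?A \<union> ?B) \<le> p + 1" by (rule thin)
  \<comment> \<open>A common member would be comparable with itself. The two families then have at
    least \<open>2 * p\<close> members together, which exceeds \<open>p + 1\<close>.\<close>
  moreover have "?A \<inter> ?B = {}" using incomparable by blast
  then have "card (?A \<union> ?B) = card ?A + card ?B" using fin by (intro card_Un_disjoint) auto
  ultimately show False using cA cB p_gt_1 by linarith
qed

end

theorem theorem3p5:
  fixes p :: nat and G :: "('a, 'b) monoid_scheme"
  assumes "prime p" and "odd p"
    and "thin_p_group p G"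
    and "\<not> cyclic_group G"
  shows "\<exists>\<phi> \<in> carrier (AutoGroup G). group.ord (AutoGroup G) \<phi> = p \<and> \<phi> \<notin> inner_auto G"
proof (rule ccontr)
  assume neg: "\<not> ?thesis"
  have fin: "finite_p_group p G"
    and thin: "\<And>\<A>. antichain_in G \<A> \<Longrightarrow> card \<A> \<le> p + 1"
    using assms(3) by (auto simp: thin_p_group_def)
  have "carrier (AutoGroup G) = auto G" by (simp add: AutoGroup_def)
  then have "\<phi> \<in> inner_auto G" if "\<phi> \<in> auto G" "group.ord (AutoGroup G) \<phi> = p" for \<phi>
    using neg that by auto
  then have "thin_counterexample G p"
    using fin thin assms
    by (intro thin_counterexample.intro finite_p_grp.intro finite_p_grp_axioms.intro
        thin_counterexample_axioms.intro) (auto simp: finite_p_group_def)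
  then show False by (rule thin_counterexample.contradiction)
qed

end
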